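(* Let $d\in(0,\tfrac12)$, let $\mathcal{D}$ be a distribution on $\mathcal{X}\times\{+1,-1\}$, and let $\mathcal{K}$ be a Mercer kernel on $\mathcal{X}$ with $\tau=\sup_{\mathbf{x},\mathbf{y}\in\mathcal{X}}\sqrt{|\mathcal{K}(\mathbf{x},\mathbf{y})|}<\infty$. Suppose that, for some $0<\beta\le1$ and $c_\beta>0$, the approximation error satisfies $\mathcal{A}(\lambda_2)\le c_\beta\lambda_2^\beta$ for all $\lambda_2>0$. Take $\lambda_1=N^{-\frac{\beta+1}{4\beta+2}}$ and let $(f_{\lambda_1,S}^*,\rho_{\lambda_1,S}^* )$ be the optimal solution of SDR-SVM with parameter $\lambda_1$ on a training set $S$ of $N$ i.i.d. examples from $\mathcal{D}$. Then there is a constant $\tilde c$ independent of $\delta$ and $N$ such that for any $0<\delta\le1$, $$\mathcal{R}_d(f_{\lambda_1,S}^*,\rho_{\lambda_1,S}^* )-\mathcal{R}_d(f_d^*,\rho_d^* )\le\tilde c\left(\log\frac4\delta\right)^{1/2}N^{-\frac{\beta}{4\beta+2}}$$ with probability at least $1-\delta$.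
   Context: $\mathcal{X}\subseteq\mathbb{R}^n$. A Mercer kernel is a continuous, symmetric, positive semi-definite $\mathcal{K}:\mathcal{X}\times\mathcal{X}\to\mathbb{R}_+$, with RKHS $\mathcal{H}_{\mathcal{K}}$ and norm $\|\cdot\|_{\mathcal{K}}$. Write $[a]_+=\max(0,a)$, $\mathbf{1}_{\{\cdot\}}$ for the indicator, $\eta(\mathbf{x})=P(y=1\mid\mathbf{x})$. The reject-option loss is $L_d(yf(\mathbf{x}),\rho)=\mathbf{1}_{\{yf(\mathbf{x})<-\rho\}}+d\,\mathbf{1}_{\{|f(\mathbf{x})|\le\rho\}}$ and the double ramp loss (slope parameter $\mu=1$) is $$L_{dr}(t,\rho)=d\Big[[1-t+\rho]_+-[-1-t+\rho]_+\Big]+(1-d)\Big[[1-t-\rho]_+-[-1-t-\rho]_+\Big].$$ The parameter $\rho$ always ranges over $\rho\ge1$. The risks are $\mathcal{R}_d(f,\rho)=\mathbb{E}_{\mathcal{D}}[L_d(yf(\mathbf{x}),\rho)]$, $\mathcal{R}_{dr}(f,\rho)=\mathbb{E}_{\mathcal{D}}[L_{dr}(yf(\mathbf{x}),\rho)]$; for $S=\{(\mathbf{x}_i,y_i)\}_{i=1}^N$ the empirical risk is $\hat{\mathcal{R}}_{dr}(f,\rho)=\frac1N\sum_{i=1}^N L_{dr}(y_if(\mathbf{x}_i),\rho)$. $(f_d^*,\rho_d^* )$ denotes the generalized Bayes (optimal) reject option classifier, whose risks are the optimal ones: $\mathcal{R}_d(f_d^*,\rho_d^* )=\mathbb{E}[\xi(\eta(\mathbf{x}))]$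 with $\xi(\eta)=\eta\mathbf{1}_{\{\eta<d\}}+d\mathbf{1}_{\{d\le\eta\le1-d\}}+(1-\eta)\mathbf{1}_{\{\eta>1-d\}}$, and $\mathcal{R}_{dr}(f_d^*,\rho_d^* )=\mathbb{E}[H(\eta(\mathbf{x}))]$ with $H(\eta)=\inf_{z\in\mathbb{R},\rho\ge1}\eta L_{dr}(z,\rho)+(1-\eta)L_{dr}(-z,\rho)$. The optimal solution of SDR-SVM with parameter $\lambda_1>0$: let $\mathcal{H}_{\mathcal{K},S}^+=\{\sum_{i=1}^N y_i\alpha_i\mathcal{K}(\mathbf{x}_i,\cdot):\alpha\in\mathbb{R}_+^N\}$ and $\Omega(h)=\sum_i\alpha_i$ for $h=\sum_i y_i\alpha_i\mathcal{K}(\mathbf{x}_i,\cdot)$, $\alpha_i\ge0$ (the infimum over such representations if not unique); $(h_{\lambda_1,S}^*,b_{\lambda_1,S}^*,\rho_{\lambda_1,S}^* )$ is a global minimizer of $\lambda_1\Omega(h)+\hat{\mathcal{R}}_{dr}(h+b,\rho)$ over $h\in\mathcal{H}_{\mathcal{K},S}^+$, $b\in\mathbb{R}$, $\rho\ge1$, and $f_{\lambda_1,S}^*=h_{\lambda_1,S}^*+b_{\lambda_1,S}^*$. The approximation error is $$\mathcal{A}(\lambda_2)=\inf_{h\in\mathcal{H}_{\mathcal{K}},\,b\in\mathbb{R},\,\rho\ge1}\ \frac{\lambda_2}{2}\|h\|_{\mathcal{K}}^2+\mathcal{R}_{dr}(h+b,\rho)-\mathcal{R}_{dr}(f_d^*,\rho_d^*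 ),\qquad\lambda_2>0.$$ *)

theory Defs
  imports "HOL-Probability.Probability"
begin

subsection \<open>Losses and risks\<close>

definition pos_part :: "real \<Rightarrow> real" where
  "pos_part a = max 0 a"

text \<open>The margin argument \<open>t\<close> stands for \<open>y f(x)\<close>; labels are \<open>1\<close> and \<open>-1\<close>, so
  \<open>\<bar>t\<bar> = \<bar>f(x)\<bar>\<close>.\<close>

definition loss_d :: "real \<Rightarrow> real \<Rightarrow> real \<Rightarrow> real" where
  "loss_d d t \<rho> = of_bool (t < - \<rho>) + d * of_bool (\<bar>t\<bar> \<le> \<rho>)"

definition loss_dr :: "real \<Rightarrow> real \<Rightarrow> real \<Rightarrow> real" where
  "loss_dr d t \<rho> =
     d * (pos_part (1 - t + \<rho>) - pos_part (- 1 - t + \<rho>))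
     + (1 - d) * (pos_part (1 - t - \<rho>) - pos_part (- 1 - t - \<rho>))"

definition labelled_distribution :: "'a::topological_space set \<Rightarrow> ('a \<times> real) measure \<Rightarrow> bool" where
  "labelled_distribution X D \<longleftrightarrow>
     prob_space D \<and> sets D = sets (restrict_space borel X \<Otimes>\<^sub>M count_space {-1, 1})"

definition risk_d :: "('a \<times> real) measure \<Rightarrow> real \<Rightarrow> ('a \<Rightarrow> real) \<Rightarrow> real \<Rightarrow> real" where
  "risk_d D d f \<rho> = (\<integral>z. loss_d d (snd z * f (fst z)) \<rho> \<partial>D)"

definition risk_dr :: "('a \<times> real) measure \<Rightarrow> real \<Rightarrow> ('a \<Rightarrow> real) \<Rightarrow> real \<Rightarrow> real" where
  "risk_dr D d f \<rho> = (\<integral>z. loss_dr d (snd z * f (fst z)) \<rho> \<partial>D)"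

definition emp_risk_dr :: "nat \<Rightarrow> (nat \<Rightarrow> 'a \<times> real) \<Rightarrow> real \<Rightarrow> ('a \<Rightarrow> real) \<Rightarrow> real \<Rightarrow> real" where
  "emp_risk_dr N S d f \<rho> = (\<Sum>i<N. loss_dr d (snd (S i) * f (fst (S i))) \<rho>) / real N"

subsection \<open>Risks of the generalized Bayes classifier\<close>

text \<open>A version of \<open>P(y = 1 | x)\<close>. It is a function of the pair \<open>z = (x, y)\<close>, but measurable
  with respect to the \<open>\<sigma>\<close>-algebra generated by the first coordinate, hence a function of \<open>x\<close> only.\<close>

definition eta :: "('a::topological_space \<times> real) measure \<Rightarrow> 'a \<times> real \<Rightarrow> real" where
  "eta D = real_cond_exp D (vimage_algebra (space D) fst borel) (indicator {z. snd z = 1})"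

definition xi :: "real \<Rightarrow> real \<Rightarrow> real" where
  "xi d e = e * of_bool (e < d) + d * of_bool (d \<le> e \<and> e \<le> 1 - d) + (1 - e) * of_bool (e > 1 - d)"

definition cond_opt_dr :: "real \<Rightarrow> real \<Rightarrow> real" where
  "cond_opt_dr d e =
     (INF (z, \<rho>) \<in> UNIV \<times> {1..}. e * loss_dr d z \<rho> + (1 - e) * loss_dr d (- z) \<rho>)"

text \<open>The generalized Bayes classifier enters only through its two risks, which are the
  following expectations.\<close>

definition bayes_risk_d :: "('a::topological_space \<times> real) measure \<Rightarrow> real \<Rightarrow> real" where
  "bayes_risk_d D d = (\<integral>z. xi d (eta D z) \<partial>D)"

definition bayes_risk_dr :: "('a::topological_space \<times> real) measure \<Rightarrow> real \<Rightarrow> real" where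
  "bayes_risk_dr D d = (\<integral>z. cond_opt_dr d (eta D z) \<partial>D)"

subsection \<open>Mercer kernels and their reproducing kernel Hilbert spaces\<close>

definition mercer_kernel ::
  "'a::topological_space set \<Rightarrow> ('a \<Rightarrow> 'a \<Rightarrow> real) \<Rightarrow> bool" where
  "mercer_kernel X K \<longleftrightarrow>
     continuous_on (X \<times> X) (\<lambda>(x, y). K x y) \<and>
     (\<forall>x\<in>X. \<forall>y\<in>X. K x y = K y x) \<and>
     (\<forall>x\<in>X. \<forall>y\<in>X. 0 \<le> K x y) \<and>
     (\<forall>A c. finite A \<longrightarrow> A \<subseteq> X \<longrightarrow> 0 \<le> (\<Sum>x\<in>A. \<Sum>y\<in>A. c x * c y * K x y))"

text \<open>Functions on \<open>X\<close> are represented by total functions vanishing outside \<open>X\<close>, so that equality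
  of representatives is equality on \<open>X\<close>.\<close>

definition kernel_section :: "'a set \<Rightarrow> ('a \<Rightarrow> 'a \<Rightarrow> real) \<Rightarrow> 'a \<Rightarrow> 'a \<Rightarrow> real" where
  "kernel_section X K x = (\<lambda>t. if t \<in> X then K x t else 0)"

definition ip_norm :: "(('a \<Rightarrow> real) \<Rightarrow> ('a \<Rightarrow> real) \<Rightarrow> real) \<Rightarrow> ('a \<Rightarrow> real) \<Rightarrow> real" where
  "ip_norm ip f = sqrt (ip f f)"

text \<open>\<open>H\<close> with inner product \<open>ip\<close> is the Hilbert space of functions on \<open>X\<close> with reproducing
  kernel \<open>K\<close>; it exists and is unique for every positive semi-definite \<open>K\<close> (Moore--Aronszajn).\<close>

locale rkhs =
  fixes X :: "'a set"
    and K :: "'a \<Rightarrow> 'a \<Rightarrow> real"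
    and H :: "('a \<Rightarrow> real) set"
    and ip :: "('a \<Rightarrow> real) \<Rightarrow> ('a \<Rightarrow> real) \<Rightarrow> real"
  assumes supported: "f \<in> H \<Longrightarrow> x \<notin> X \<Longrightarrow> f x = 0"
    and zero_mem: "(\<lambda>_. 0) \<in> H"
    and add_mem: "f \<in> H \<Longrightarrow> g \<in> H \<Longrightarrow> (\<lambda>x. f x + g x) \<in> H"
    and scale_mem: "f \<in> H \<Longrightarrow> (\<lambda>x. c * f x) \<in> H"
    and ip_commute: "f \<in> H \<Longrightarrow> g \<in> H \<Longrightarrow> ip f g = ip g f"
    and ip_add: "f \<in> H \<Longrightarrow> g \<in> H \<Longrightarrow> h \<in> H \<Longrightarrow> ip (\<lambda>x. f x + g x) h = ip f h + ip g h"
    and ip_scale: "f \<in> H \<Longrightarrow> g \<in> H \<Longrightarrow> ip (\<lambda>x. c * f x) g = c * ip f g"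
    and ip_nonneg: "f \<in> H \<Longrightarrow> 0 \<le> ip f f"
    and ip_definite: "f \<in> H \<Longrightarrow> ip f f = 0 \<Longrightarrow> f = (\<lambda>_. 0)"
    and complete:
      "(\<And>n. s n \<in> H) \<Longrightarrow>
       (\<And>e. e > 0 \<Longrightarrow> \<exists>M. \<forall>m\<ge>M. \<forall>n\<ge>M. ip_norm ip (\<lambda>x. s m x - s n x) < e) \<Longrightarrow>
       \<exists>f\<in>H. (\<lambda>n::nat. ip_norm ip (\<lambda>x. s n x - f x)) \<longlonglongrightarrow> 0"
    and section_mem: "x \<in> X \<Longrightarrow> kernel_section X K x \<in> H"
    and reproducing: "f \<in> H \<Longrightarrow> x \<in> X \<Longrightarrow> ip f (kernel_section X K x) = f x"

definition approx_error ::
  "('a::topological_space \<times> real) measure \<Rightarrow> real \<Rightarrow> ('a \<Rightarrow> real) set \<Rightarrow>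
   (('a \<Rightarrow> real) \<Rightarrow> ('a \<Rightarrow> real) \<Rightarrow> real) \<Rightarrow> real \<Rightarrow> real" where
  "approx_error D d H ip lam2 =
     (INF (h, b, \<rho>) \<in> H \<times> UNIV \<times> {1..}.
        lam2 / 2 * (ip_norm ip h)\<^sup>2 + risk_dr D d (\<lambda>x. h x + b) \<rho> - bayes_risk_dr D d)"

subsection \<open>SDR-SVM\<close>

definition kernel_expansion ::
  "'a set \<Rightarrow> ('a \<Rightarrow> 'a \<Rightarrow> real) \<Rightarrow> nat \<Rightarrow> (nat \<Rightarrow> 'a \<times> real) \<Rightarrow> (nat \<Rightarrow> real) \<Rightarrow> 'a \<Rightarrow> real" where
  "kernel_expansion X K N S \<alpha> =
     (\<lambda>t. \<Sum>i<N. snd (S i) * \<alpha> i * kernel_section X K (fst (S i)) t)"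

definition H_plus ::
  "'a set \<Rightarrow> ('a \<Rightarrow> 'a \<Rightarrow> real) \<Rightarrow> nat \<Rightarrow> (nat \<Rightarrow> 'a \<times> real) \<Rightarrow> ('a \<Rightarrow> real) set" where
  "H_plus X K N S = {kernel_expansion X K N S \<alpha> | \<alpha>. \<forall>i<N. 0 \<le> \<alpha> i}"

definition Omega ::
  "'a set \<Rightarrow> ('a \<Rightarrow> 'a \<Rightarrow> real) \<Rightarrow> nat \<Rightarrow> (nat \<Rightarrow> 'a \<times> real) \<Rightarrow> ('a \<Rightarrow> real) \<Rightarrow> real" where
  "Omega X K N S h =
     Inf {\<Sum>i<N. \<alpha> i | \<alpha>. (\<forall>i<N. 0 \<le> \<alpha> i) \<and> h = kernel_expansion X K N S \<alpha>}"

definition sdr_objective ::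
  "'a set \<Rightarrow> ('a \<Rightarrow> 'a \<Rightarrow> real) \<Rightarrow> real \<Rightarrow> nat \<Rightarrow> (nat \<Rightarrow> 'a \<times> real) \<Rightarrow> real \<Rightarrow>
   ('a \<Rightarrow> real) \<Rightarrow> real \<Rightarrow> real \<Rightarrow> real" where
  "sdr_objective X K d N S lam1 h b \<rho> =
     lam1 * Omega X K N S h + emp_risk_dr N S d (\<lambda>x. h x + b) \<rho>"

definition sdr_svm_solution ::
  "'a set \<Rightarrow> ('a \<Rightarrow> 'a \<Rightarrow> real) \<Rightarrow> real \<Rightarrow> nat \<Rightarrow> (nat \<Rightarrow> 'a \<times> real) \<Rightarrow> real \<Rightarrow>
   ('a \<Rightarrow> real) \<Rightarrow> real \<Rightarrow> real \<Rightarrow> bool" where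
  "sdr_svm_solution X K d N S lam1 h b \<rho> \<longleftrightarrow>
     h \<in> H_plus X K N S \<and> 1 \<le> \<rho> \<and>
     (\<forall>h'\<in>H_plus X K N S. \<forall>b'. \<forall>\<rho>'\<ge>1.
        sdr_objective X K d N S lam1 h b \<rho> \<le> sdr_objective X K d N S lam1 h' b' \<rho>')"

text \<open>\<open>P\<close> holds with probability at least \<open>p\<close> over \<open>N\<close> i.i.d. draws from \<open>D\<close>. The set of samples
  satisfying \<open>P\<close> need not be measurable, so it is only required to contain an event of
  probability at least \<open>p\<close>; for measurable \<open>P\<close> this is the usual meaning.\<close>

definition iid_with_prob_ge ::
  "'z measure \<Rightarrow> nat \<Rightarrow> real \<Rightarrow> ((nat \<Rightarrow> 'z) \<Rightarrow> bool) \<Rightarrow> bool" where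
  "iid_with_prob_ge D N p P \<longleftrightarrow>
     (\<exists>E\<in>sets (Pi\<^sub>M {..<N} (\<lambda>_. D)). p \<le> measure (Pi\<^sub>M {..<N} (\<lambda>_. D)) E \<and> (\<forall>S\<in>E. P S))"

end

(* The excess reject-option risk is at most the excess double ramp risk: for fixed conditional
   probability both conditional risks are piecewise linear in the margin, with optimal values
   min(e, d, 1 - e) and 2 min(e, d, 1 - e). The double ramp loss is a convex combination of two
   shifted ramps.

   Empirical side: given any h0 in the RKHS, maximizing the dual of a hinge-penalized projection over
   the box [0, 1/(lambda2 N)]^N yields an expansion with nonnegative coefficients, Omega at most
   1/lambda2, whose empirical double ramp risk exceeds that of h0 by at most lambda2/2 ||h0||^2.
   Comparing the SDR-SVM solution with it costs lambda1/lambda2 plus the approximation error at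
   lambda2 = N^(-1/(4 beta + 2)).

   Stochastic side: the solution has coefficient sum O(1/lambda1), and McDiarmid's inequality,
   symmetrization and the contraction principle bound the uniform deviation over such expansions
   by O(1/(lambda1 sqrt N)). All these terms are of order N^(-beta/(4 beta + 2)). *)

theory Submission
  imports Defs
begin

section \<open>Concentration and symmetrization\<close>

text \<open>The hypothesis space of SDR-SVM depends on the sample, so the uniform deviation is taken
  over a class fixed in advance: expansions at arbitrary points of \<open>X\<close> whose
  coefficients have bounded absolute sum. \<open>b\<close> and \<open>\<rho>\<close> are unbounded,
  but a ramp is constant away from [-1, 1], so offsets can be clipped at a bound given by the kernel
  and the coefficient sum. The class is still uncountable; measurability of its supremum comes from
  a countable dense subset, on which the supremum is already determined.

  The reference function \<open>h0\<close> depends on \<open>N\<close> but not on the sample. Hence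
  its own empirical fluctuation has mean zero and goes under the same application of McDiarmid's
  inequality; a single event is enough.

  Only the exponent of lambda1 is prescribed. lambda2 is the value at which lambda1 / lambda2 equals
  lambda2^beta, and both then equal 1 / (lambda1 sqrt N).\<close>

lemma integrable_bounded_prob:
  fixes f :: "'a \<Rightarrow> real"
  assumes "prob_space M" "f \<in> borel_measurable M" "\<And>x. x \<in> space M \<Longrightarrow> \<bar>f x\<bar> \<le> B"
  shows "integrable M f"
proof -
  interpret prob_space M by fact
  show ?thesis using assms by (intro integrable_const_bound[where B = B]) auto
qed

lemma abs_integral_le_prob:
  fixes f :: "'a \<Rightarrow> real"
  assumes "prob_space M" "f \<in> borel_measurable M" "\<And>x. x \<in> space M \<Longrightarrow> \<bar>f x\<bar> \<le> B"
  shows "\<bar>\<integral>x. f x \<partial>M\<bar> \<le> B"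
proof -
  interpret prob_space M by fact
  have "\<bar>\<integral>x. f x \<partial>M\<bar> \<le> (\<integral>x. \<bar>f x\<bar> \<partial>M)" by (rule integral_abs_bound)
  also have "\<dots> \<le> (\<integral>x. B \<partial>M)"
    using integrable_bounded_prob[OF assms] assms(3) by (intro integral_mono integrable_abs) auto
  finally show ?thesis by (simp add: prob_space)
qed

text \<open>Only the oscillation of \<open>f\<close> is controlled, not its location;
  \<open>f\<close> lies in an interval of length \<open>c\<close> starting at its infimum, and
  Hoeffding's lemma depends on the length alone.\<close>

lemma hoeffding_lemma_width:
  fixes f :: "'a \<Rightarrow> real"
  assumes "prob_space M" and [measurable]: "f \<in> borel_measurable M"
    and width: "\<And>x y. x \<in> space M \<Longrightarrow> y \<in> space M \<Longrightarrow> f x - f y \<le> c"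
    and "0 < l"
  shows "(\<integral>x. exp (l * f x) \<partial>M) \<le> exp (l * (\<integral>x. f x \<partial>M) + l\<^sup>2 * c\<^sup>2 / 8)"
proof -
  interpret prob_space M by fact
  define a where "a = (INF x\<in>space M. f x)"
  obtain x0 where x0: "x0 \<in> space M" using not_empty by blast
  have bdd: "bdd_below (f ` space M)"
    using width[OF x0] by (auto intro!: bdd_belowI[of _ "f x0 - c"] simp: algebra_simps)
  have low: "a \<le> f x" if "x \<in> space M" for x
    unfolding a_def using bdd that by (rule cINF_lower)
  have up: "f x \<le> a + c" if "x \<in> space M" for x
  proof -
    have "f x - c \<le> a" unfolding a_def
      using x0 width[OF that] by (intro cINF_greatest) (auto simp: algebra_simps)
    then show ?thesis by simp
  qed
  interpret I: interval_bounded_random_variable M f a "a + c"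
    by unfold_locales (auto simp: low up)
  let ?m = "expectation f"
  have int: "integrable M (\<lambda>x. exp (l * (f x - ?m)))"
  proof (rule integrable_bounded_prob[OF assms(1), where B = "exp (l * (a + c - ?m))"])
    fix x assume "x \<in> space M"
    then show "\<bar>exp (l * (f x - ?m))\<bar> \<le> exp (l * (a + c - ?m))"
      using up \<open>0 < l\<close> by auto
  qed simp
  have "ennreal (\<integral>x. exp (l * (f x - ?m)) \<partial>M) = (\<integral>\<^sup>+x. exp (l * (f x - ?m)) \<partial>M)"
    using int by (intro nn_integral_eq_integral[symmetric]) auto
  also have "\<dots> \<le> ennreal (exp (l\<^sup>2 * c\<^sup>2 / 8))"
    using I.Hoeffdings_lemma_nn_integral[OF \<open>0 < l\<close>] by simp
  finally have *: "(\<integral>x. exp (l * (f x - ?m)) \<partial>M) \<le> exp (l\<^sup>2 * c\<^sup>2 / 8)"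
    by (simp add: ennreal_le_iff)
  have "(\<integral>x. exp (l * f x) \<partial>M) = (\<integral>x. exp (l * ?m) * exp (l * (f x - ?m)) \<partial>M)"
    by (simp add: exp_add[symmetric] algebra_simps)
  also have "\<dots> = exp (l * ?m) * (\<integral>x. exp (l * (f x - ?m)) \<partial>M)"
    by simp
  also have "\<dots> \<le> exp (l * ?m) * exp (l\<^sup>2 * c\<^sup>2 / 8)"
    using * by (intro mult_left_mono) auto
  finally show ?thesis by (simp add: exp_add)
qed

section \<open>Bounded differences on finite product spaces\<close>

lemma integral_PiM_Suc:
  fixes f :: "(nat \<Rightarrow> 'a) \<Rightarrow> real"
  assumes "prob_space M" "integrable (Pi\<^sub>M {..<Suc n} (\<lambda>_. M)) f"
  shows "integral\<^sup>L (Pi\<^sub>M {..<Suc n} (\<lambda>_. M)) f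
    = (\<integral>S. (\<integral>z. f (S(n := z)) \<partial>M) \<partial>Pi\<^sub>M {..<n} (\<lambda>_. M))"
proof -
  interpret prob_space M by fact
  interpret product_sigma_finite "\<lambda>_. M" ..
  show ?thesis
    using product_integral_insert[of "{..<n}" n f] assms(2) by (simp add: lessThan_Suc)
qed

lemma measurable_fun_upd_Suc [measurable]:
  "(\<lambda>(S, z). S(n := z)) \<in> Pi\<^sub>M {..<n} (\<lambda>_. M) \<Otimes>\<^sub>M M \<rightarrow>\<^sub>M Pi\<^sub>M {..<Suc n} (\<lambda>_. M)"
  using measurable_add_dim[of n "{..<n}" "\<lambda>_. M"] by (simp add: lessThan_Suc)

lemma fun_upd_space_PiM:
  assumes "S \<in> space (Pi\<^sub>M {..<n} (\<lambda>_. M))" "z \<in> space M"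
  shows "S(n := z) \<in> space (Pi\<^sub>M {..<Suc n} (\<lambda>_. M))"
  using assms by (auto simp: space_PiM lessThan_Suc PiE_def extensional_def)

text \<open>Induction on the number of coordinates in place of a martingale: with the others fixed,
  integrating out the last one costs a factor exp (l^2 c^2 / 8) by Hoeffding's lemma, and the
  averaged function \<open>G\<close> again has differences at most \<open>c\<close>.\<close>

lemma mcdiarmid_mgf:
  fixes F :: "(nat \<Rightarrow> 'a) \<Rightarrow> real"
  assumes M: "prob_space M"
    and "F \<in> borel_measurable (Pi\<^sub>M {..<n} (\<lambda>_. M))"
    and "\<And>S. S \<in> space (Pi\<^sub>M {..<n} (\<lambda>_. M)) \<Longrightarrow> \<bar>F S\<bar> \<le> B"
    and "\<And>S i z. S \<in> space (Pi\<^sub>M {..<n} (\<lambda>_. M)) \<Longrightarrow> i < n \<Longrightarrow> z \<in> space M \<Longrightarrow>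
      F S - F (S(i := z)) \<le> c"
    and "0 < l"
  shows "(\<integral>S. exp (l * F S) \<partial>Pi\<^sub>M {..<n} (\<lambda>_. M))
    \<le> exp (l * (\<integral>S. F S \<partial>Pi\<^sub>M {..<n} (\<lambda>_. M)) + real n * (l\<^sup>2 * c\<^sup>2 / 8))"
  using assms(2-4)
proof (induction n arbitrary: F)
  case 0
  interpret P: prob_space "Pi\<^sub>M {..<0::nat} (\<lambda>_. M)" by (rule prob_space_PiM[OF M])
  have "(\<integral>S. G S \<partial>Pi\<^sub>M {..<0::nat} (\<lambda>_. M)) = G (\<lambda>_. undefined)" for G :: "(nat \<Rightarrow> 'a) \<Rightarrow> real"
  proof -
    have "(\<integral>S. G S \<partial>Pi\<^sub>M {..<0::nat} (\<lambda>_. M)) = (\<integral>S. G (\<lambda>_. undefined) \<partial>Pi\<^sub>M {..<0::nat} (\<lambda>_. M))"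
      by (intro Bochner_Integration.integral_cong) (auto simp: space_PiM)
    then show ?thesis using P.prob_space by simp
  qed
  then show ?case by simp
next
  case (Suc n)
  let ?P = "Pi\<^sub>M {..<n} (\<lambda>_. M)" and ?Q = "Pi\<^sub>M {..<Suc n} (\<lambda>_. M)"
  interpret M: prob_space M by fact
  interpret P: prob_space ?P by (rule prob_space_PiM[OF M])
  note [measurable] = Suc.prems(1)
  note sp = fun_upd_space_PiM[where M = M and n = n]
  define G where "G S = (\<integral>z. F (S(n := z)) \<partial>M)" for S
  have upd [measurable]: "(\<lambda>z. F (S(n := z))) \<in> borel_measurable M" if "S \<in> space ?P" for S
  proof -
    have "(\<lambda>z. (S, z)) \<in> M \<rightarrow>\<^sub>M ?P \<Otimes>\<^sub>M M" using that by simp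
    from measurable_compose[OF measurable_compose[OF this measurable_fun_upd_Suc] Suc.prems(1)]
    show ?thesis by (simp add: fun_upd_def)
  qed
  have intF: "integrable M (\<lambda>z. F (S(n := z)))" if "S \<in> space ?P" for S
    using that by (intro integrable_bounded_prob[OF M, where B = B] Suc.prems(2) sp upd) auto
  have F2 [measurable]: "(\<lambda>(S, z). F (S(n := z))) \<in> borel_measurable (?P \<Otimes>\<^sub>M M)"
    using measurable_compose[OF measurable_fun_upd_Suc Suc.prems(1)] by (simp add: case_prod_unfold)
  have Gm [measurable]: "G \<in> borel_measurable ?P"
    unfolding G_def[abs_def] by measurable
  have Gb: "\<bar>G S\<bar> \<le> B" if "S \<in> space ?P" for S
    unfolding G_def using that by (intro abs_integral_le_prob[OF M upd] Suc.prems(2) sp)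
  have Gd: "G S - G (S(i := z)) \<le> c" if S: "S \<in> space ?P" and i: "i < n" "z \<in> space M" for S i z
  proof -
    have S': "S(i := z) \<in> space ?P"
      using that by (auto simp: space_PiM PiE_def extensional_def)
    have "G S - G (S(i := z)) = (\<integral>w. F (S(n := w)) - F (S(i := z, n := w)) \<partial>M)"
      unfolding G_def using intF[OF S] intF[OF S'] by simp
    also have "\<dots> \<le> (\<integral>w. c \<partial>M)"
    proof (intro integral_mono)
      fix w assume "w \<in> space M"
      \<comment> \<open>Since \<open>i < n\<close> the two updates commute, so the difference of the
        averages is an average of differences of \<open>F\<close> in coordinate
        \<open>i\<close>.\<close>
      have "S(i := z, n := w) = S(n := w, i := z)"
        using i by (intro fun_upd_twist) simp
      with Suc.prems(3)[OF sp[OF S \<open>w \<in> space M\<close>], of i z] i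
      show "F (S(n := w)) - F (S(i := z, n := w)) \<le> c" by (simp add: fun_upd_def)
    qed (use intF[OF S] intF[OF S'] in auto)
    finally show ?thesis by (simp add: M.prob_space)
  qed
  have intQ: "integrable ?Q F"
    by (rule integrable_bounded_prob[OF prob_space_PiM[OF M] Suc.prems(1,2)])
  have intE: "integrable ?Q (\<lambda>S. exp (l * F S))"
    using \<open>0 < l\<close> Suc.prems(2)
    by (intro integrable_bounded_prob[OF prob_space_PiM[OF M], where B = "exp (l * B)"])
       (auto simp: abs_le_iff)
  have intE': "integrable ?P (\<lambda>S. exp (l * G S + l\<^sup>2 * c\<^sup>2 / 8))"
    using \<open>0 < l\<close> Gb
    by (intro integrable_bounded_prob[OF prob_space_PiM[OF M], where B = "exp (l * B + l\<^sup>2 * c\<^sup>2 / 8)"])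
       (auto simp: abs_le_iff)
  have "(\<integral>S. exp (l * F S) \<partial>?Q) = (\<integral>S. (\<integral>z. exp (l * F (S(n := z))) \<partial>M) \<partial>?P)"
    using integral_PiM_Suc[OF M intE] by simp
  also have "\<dots> \<le> (\<integral>S. exp (l * G S + l\<^sup>2 * c\<^sup>2 / 8) \<partial>?P)"
  proof (rule integral_mono_AE')
    show "AE S in ?P. (\<integral>z. exp (l * F (S(n := z))) \<partial>M) \<le> exp (l * G S + l\<^sup>2 * c\<^sup>2 / 8)"
    proof (rule AE_I2)
      fix S assume S: "S \<in> space ?P"
      show "(\<integral>z. exp (l * F (S(n := z))) \<partial>M) \<le> exp (l * G S + l\<^sup>2 * c\<^sup>2 / 8)"
        unfolding G_def
      proof (rule hoeffding_lemma_width[OF M upd[OF S] _ \<open>0 < l\<close>])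
        fix x y assume "x \<in> space M" "y \<in> space M"
        then show "F (S(n := x)) - F (S(n := y)) \<le> c"
          using Suc.prems(3)[OF sp[OF S], of x n y] by (simp add: fun_upd_def cong: if_cong)
      qed
    qed
  qed (use intE' in auto)
  also have "\<dots> = exp (l\<^sup>2 * c\<^sup>2 / 8) * (\<integral>S. exp (l * G S) \<partial>?P)"
    by (simp add: exp_add)
  also have "\<dots> \<le> exp (l\<^sup>2 * c\<^sup>2 / 8) * exp (l * (\<integral>S. G S \<partial>?P) + real n * (l\<^sup>2 * c\<^sup>2 / 8))"
    using Suc.IH[of G, OF Gm Gb Gd] by (intro mult_left_mono) auto
  also have "(\<integral>S. G S \<partial>?P) = (\<integral>S. F S \<partial>?Q)"
    unfolding G_def by (rule integral_PiM_Suc[OF M intQ, symmetric])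
  finally show ?case by (simp add: exp_add[symmetric] algebra_simps add_divide_distrib)
qed

lemma mcdiarmid:
  fixes F :: "(nat \<Rightarrow> 'a) \<Rightarrow> real"
  assumes M: "prob_space M"
    and [measurable]: "F \<in> borel_measurable (Pi\<^sub>M {..<n} (\<lambda>_. M))"
    and bd: "\<And>S. S \<in> space (Pi\<^sub>M {..<n} (\<lambda>_. M)) \<Longrightarrow> \<bar>F S\<bar> \<le> B"
    and diff: "\<And>S i z. S \<in> space (Pi\<^sub>M {..<n} (\<lambda>_. M)) \<Longrightarrow> i < n \<Longrightarrow> z \<in> space M \<Longrightarrow>
      F S - F (S(i := z)) \<le> c"
    and pos: "0 < n" "0 < c" "0 < t"
  shows "measure (Pi\<^sub>M {..<n} (\<lambda>_. M))
      {S \<in> space (Pi\<^sub>M {..<n} (\<lambda>_. M)). (\<integral>S. F S \<partial>Pi\<^sub>M {..<n} (\<lambda>_. M)) + t \<le> F S}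
    \<le> exp (- 2 * t\<^sup>2 / (real n * c\<^sup>2))"
proof -
  let ?P = "Pi\<^sub>M {..<n} (\<lambda>_. M)"
  interpret P: prob_space ?P by (rule prob_space_PiM[OF M])
  let ?m = "\<integral>S. F S \<partial>?P"
  \<comment> \<open>The minimizer over l of n l^2 c^2 / 8 - l t, the exponent left by Markov's
    inequality.\<close>
  define l where "l = 4 * t / (real n * c\<^sup>2)"
  have l: "0 < l" using pos by (simp add: l_def)
  have intE: "integrable ?P (\<lambda>S. exp (l * F S))"
    using l bd
    by (intro integrable_bounded_prob[OF prob_space_PiM[OF M], where B = "exp (l * B)"])
       (auto simp: abs_le_iff)
  have "{S \<in> space ?P. ?m + t \<le> F S} = {S \<in> space ?P. exp (l * (?m + t)) \<le> exp (l * F S)}"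
    using l by auto
  then have "measure ?P {S \<in> space ?P. ?m + t \<le> F S} \<le> (\<integral>S. exp (l * F S) \<partial>?P) / exp (l * (?m + t))"
    using integral_Markov_inequality_measure[OF intE, of "{}" "exp (l * (?m + t))"] by simp
  also have "\<dots> \<le> exp (l * ?m + real n * (l\<^sup>2 * c\<^sup>2 / 8)) / exp (l * (?m + t))"
    using mcdiarmid_mgf[OF M assms(2) bd diff l] by (intro divide_right_mono) auto
  also have "\<dots> = exp (real n * (l\<^sup>2 * c\<^sup>2 / 8) - l * t)"
    by (simp add: exp_diff[symmetric] algebra_simps)
  also have "real n * (l\<^sup>2 * c\<^sup>2 / 8) - l * t = - 2 * t\<^sup>2 / (real n * c\<^sup>2)"
    using pos by (simp add: l_def power2_eq_square field_simps)
  finally show ?thesis .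
qed

section \<open>Symmetrization and contraction\<close>

lemma cSUP_add_symm_le:
  fixes A \<phi> l :: "'g \<Rightarrow> real"
  assumes "G \<noteq> {}"
    and bdd: "bdd_above ((\<lambda>g. A g + 2 * l g) ` G)" "bdd_above ((\<lambda>g. A g - 2 * l g) ` G)"
    and lip: "\<And>g h. g \<in> G \<Longrightarrow> h \<in> G \<Longrightarrow> \<bar>\<phi> g - \<phi> h\<bar> \<le> \<bar>l g - l h\<bar>"
  shows "(SUP g\<in>G. A g + 2 * \<phi> g) + (SUP g\<in>G. A g - 2 * \<phi> g)
    \<le> (SUP g\<in>G. A g + 2 * l g) + (SUP g\<in>G. A g - 2 * l g)"
proof -
  let ?R = "(SUP g\<in>G. A g + 2 * l g) + (SUP g\<in>G. A g - 2 * l g)"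
  \<comment> \<open>Contraction for a single sign: the left side is at most A g + A h + 2 |l g - l
    h|. Depending on the sign of l g - l h, either \<open>g\<close> goes to the first supremum on
    the right and \<open>h\<close> to the second, or the other way round.\<close>
  have *: "(A g + 2 * \<phi> g) + (A h - 2 * \<phi> h) \<le> ?R" if "g \<in> G" "h \<in> G" for g h
  proof -
    note cSUP_upper[OF that(1) bdd(1)] cSUP_upper[OF that(2) bdd(1)]
      cSUP_upper[OF that(1) bdd(2)] cSUP_upper[OF that(2) bdd(2)] lip[OF that]
    then show ?thesis by linarith
  qed
  have "(SUP g\<in>G. A g + 2 * \<phi> g) \<le> ?R - (A h - 2 * \<phi> h)" if "h \<in> G" for h
    using * that \<open>G \<noteq> {}\<close> by (intro cSUP_least) (auto simp: algebra_simps)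
  then have "(SUP g\<in>G. A g - 2 * \<phi> g) \<le> ?R - (SUP g\<in>G. A g + 2 * \<phi> g)"
    using \<open>G \<noteq> {}\<close> by (intro cSUP_least) (auto simp: algebra_simps)
  then show ?thesis by simp
qed

lemma bdd_above_abs:
  fixes f :: "'g \<Rightarrow> real"
  assumes "\<And>g. g \<in> G \<Longrightarrow> \<bar>f g\<bar> \<le> B"
  shows "bdd_above (f ` G)"
  using assms by (auto intro!: bdd_aboveI[of _ B] simp: abs_le_iff)

lemma abs_cSUP_le:
  fixes f :: "'g \<Rightarrow> real"
  assumes "G \<noteq> {}" "\<And>g. g \<in> G \<Longrightarrow> \<bar>f g\<bar> \<le> B"
  shows "\<bar>SUP g\<in>G. f g\<bar> \<le> B"
proof -
  obtain g where g: "g \<in> G" using assms(1) by blast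
  have "f g \<le> (SUP g\<in>G. f g)" by (rule cSUP_upper[OF g bdd_above_abs[OF assms(2)]])
  moreover have "(SUP g\<in>G. f g) \<le> B" using assms by (intro cSUP_least) (auto simp: abs_le_iff)
  ultimately show ?thesis using assms(2)[OF g] by (auto simp: abs_le_iff)
qed

text \<open>One coordinate of the sample is symmetrized and contracted at once. Averaging over a
  ghost point \<open>w\<close> writes the centred term as half of A + 2 \<phi>(w) plus half of A - 2
  \<phi>(z); taking the supremum of each half separately decouples the two points. The halves stand
  for the two values of a Rademacher sign.\<close>

lemma symmetrization_step:
  fixes \<phi> l :: "'g \<Rightarrow> 'z \<Rightarrow> real" and A :: "'g \<Rightarrow> real"
  assumes M: "prob_space M" and G: "countable G" "G \<noteq> {}"
    and \<phi>m: "\<And>g. g \<in> G \<Longrightarrow> \<phi> g \<in> borel_measurable M"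
    and lm: "\<And>g. g \<in> G \<Longrightarrow> l g \<in> borel_measurable M"
    and \<phi>b: "\<And>g z. g \<in> G \<Longrightarrow> z \<in> space M \<Longrightarrow> \<bar>\<phi> g z\<bar> \<le> B"
    and lb: "\<And>g z. g \<in> G \<Longrightarrow> z \<in> space M \<Longrightarrow> \<bar>l g z\<bar> \<le> B"
    and Ab: "\<And>g. g \<in> G \<Longrightarrow> \<bar>A g\<bar> \<le> C"
    and lip: "\<And>g h z. g \<in> G \<Longrightarrow> h \<in> G \<Longrightarrow> z \<in> space M \<Longrightarrow> \<bar>\<phi> g z - \<phi> h z\<bar> \<le> \<bar>l g z - l h z\<bar>"
  shows "(\<integral>z. (SUP g\<in>G. A g + ((\<integral>w. \<phi> g w \<partial>M) - \<phi> g z)) \<partial>M)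
    \<le> (\<integral>z. ((SUP g\<in>G. A g + 2 * l g z) + (SUP g\<in>G. A g - 2 * l g z)) / 2 \<partial>M)"
proof -
  interpret M: prob_space M by fact
  note [measurable] = \<phi>m lm
  define U where "U z = (SUP g\<in>G. A g + 2 * \<phi> g z)" for z
  define V where "V z = (SUP g\<in>G. A g - 2 * \<phi> g z)" for z
  have bU: "\<bar>A g + 2 * \<phi> g z\<bar> \<le> C + 2 * B" and bV: "\<bar>A g - 2 * \<phi> g z\<bar> \<le> C + 2 * B"
    if "g \<in> G" "z \<in> space M" for g z
    using Ab[OF that(1)] \<phi>b[OF that] by linarith+
  have bL: "\<bar>A g + 2 * l g z\<bar> \<le> C + 2 * B" and bL': "\<bar>A g - 2 * l g z\<bar> \<le> C + 2 * B"
    if "g \<in> G" "z \<in> space M" for g z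
    using Ab[OF that(1)] lb[OF that] by linarith+
  have Pb: "\<bar>\<integral>w. \<phi> g w \<partial>M\<bar> \<le> B" if "g \<in> G" for g
    using that by (intro abs_integral_le_prob[OF M] \<phi>m \<phi>b)
  have int\<phi>: "integrable M (\<phi> g)" if "g \<in> G" for g
    using that by (intro integrable_bounded_prob[OF M, where B = B]) (auto simp: \<phi>b)
  have [measurable]: "U \<in> borel_measurable M" "V \<in> borel_measurable M"
    unfolding U_def[abs_def] V_def[abs_def]
    using G(1) by (auto intro!: borel_measurable_cSUP bdd_above_abs[OF bU] bdd_above_abs[OF bV])
  have intU: "integrable M U"
    by (intro integrable_bounded_prob[OF M, where B = "C + 2 * B"])
       (auto simp: U_def intro!: abs_cSUP_le[OF G(2)] bU)
  have intV: "integrable M V"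
    by (intro integrable_bounded_prob[OF M, where B = "C + 2 * B"])
       (auto simp: V_def intro!: abs_cSUP_le[OF G(2)] bV)
  have intUV: "integrable M (\<lambda>w. (U w + V z) / 2)" for z
    using intU by simp
  have "(SUP g\<in>G. A g + ((\<integral>w. \<phi> g w \<partial>M) - \<phi> g z)) \<le> (\<integral>w. (U w + V z) / 2 \<partial>M)"
    if z: "z \<in> space M" for z
  proof (intro cSUP_least[OF G(2)])
    fix g assume g: "g \<in> G"
    have "A g + ((\<integral>w. \<phi> g w \<partial>M) - \<phi> g z) = (\<integral>w. ((A g + 2 * \<phi> g w) + (A g - 2 * \<phi> g z)) / 2 \<partial>M)"
      using int\<phi>[OF g] by (simp add: M.prob_space add_divide_distrib diff_divide_distrib)
    also have "\<dots> \<le> (\<integral>w. (U w + V z) / 2 \<partial>M)"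
    proof (intro integral_mono)
      fix w assume w: "w \<in> space M"
      show "((A g + 2 * \<phi> g w) + (A g - 2 * \<phi> g z)) / 2 \<le> (U w + V z) / 2"
        unfolding U_def V_def using w z g
        by (intro divide_right_mono add_mono cSUP_upper bdd_above_abs[OF bU] bdd_above_abs[OF bV]) auto
    qed (use int\<phi>[OF g] intUV in auto)
    finally show "A g + ((\<integral>w. \<phi> g w \<partial>M) - \<phi> g z) \<le> (\<integral>w. (U w + V z) / 2 \<partial>M)" .
  qed
  then have "(\<integral>z. (SUP g\<in>G. A g + ((\<integral>w. \<phi> g w \<partial>M) - \<phi> g z)) \<partial>M)
      \<le> (\<integral>z. (\<integral>w. (U w + V z) / 2 \<partial>M) \<partial>M)"
  proof (intro integral_mono)
    have bS: "\<bar>A g + ((\<integral>w. \<phi> g w \<partial>M) - \<phi> g z)\<bar> \<le> C + 2 * B" if "g \<in> G" "z \<in> space M" for g z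
      using Ab[OF that(1)] \<phi>b[OF that] Pb[OF that(1)] by linarith
    show "integrable M (\<lambda>z. SUP g\<in>G. A g + ((\<integral>w. \<phi> g w \<partial>M) - \<phi> g z))"
      using G
      by (intro integrable_bounded_prob[OF M, where B = "C + 2 * B"])
         (auto intro!: borel_measurable_cSUP bdd_above_abs[OF bS] abs_cSUP_le bS)
  qed (use intU intV in \<open>auto simp: add_divide_distrib M.prob_space\<close>)
  \<comment> \<open>\<open>w\<close> and \<open>z\<close> have the same law, so the decoupled
    suprema may be evaluated at one common point, where the contraction inequality applies.\<close>
  also have "\<dots> = (\<integral>z. (U z + V z) / 2 \<partial>M)"
    using intU intV by (simp add: add_divide_distrib M.prob_space)
  also have "\<dots> \<le> (\<integral>z. ((SUP g\<in>G. A g + 2 * l g z) + (SUP g\<in>G. A g - 2 * l g z)) / 2 \<partial>M)"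
  proof (intro integral_mono)
    fix z assume z: "z \<in> space M"
    show "(U z + V z) / 2 \<le> ((SUP g\<in>G. A g + 2 * l g z) + (SUP g\<in>G. A g - 2 * l g z)) / 2"
      unfolding U_def V_def using z
      by (intro divide_right_mono cSUP_add_symm_le[OF G(2)] bdd_above_abs[OF bL] bdd_above_abs[OF bL'] lip) auto
  next
    have "integrable M (\<lambda>z. SUP g\<in>G. A g + 2 * l g z)"
      using G by (intro integrable_bounded_prob[OF M, where B = "C + 2 * B"])
         (auto intro!: borel_measurable_cSUP bdd_above_abs[OF bL] abs_cSUP_le bL)
    moreover have "integrable M (\<lambda>z. SUP g\<in>G. A g - 2 * l g z)"
      using G by (intro integrable_bounded_prob[OF M, where B = "C + 2 * B"])
         (auto intro!: borel_measurable_cSUP bdd_above_abs[OF bL'] abs_cSUP_le bL')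
    ultimately show "integrable M (\<lambda>z. ((SUP g\<in>G. A g + 2 * l g z) + (SUP g\<in>G. A g - 2 * l g z)) / 2)"
      by simp
  qed (use intU intV in auto)
  finally show ?thesis .
qed

text \<open>The recursion \<open>\<Psi> n v1 + \<Psi> n v2 \<le> 2 \<Psi> (Suc n) v\<close> lets the \<open>\<Psi>\<close> absorb one
  Rademacher sign at a time, so the signs never have to be introduced as random variables.\<close>

lemma expected_uniform_deviation_le_potential:
  fixes \<phi> l :: "'g \<Rightarrow> 'z \<Rightarrow> real" and pair :: "'v \<Rightarrow> 'g \<Rightarrow> real" and \<Psi> :: "nat \<Rightarrow> 'v \<Rightarrow> real"
  assumes M: "prob_space M" and G: "countable G" "G \<noteq> {}"
    and \<phi>m: "\<And>g. g \<in> G \<Longrightarrow> \<phi> g \<in> borel_measurable M"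
    and lm: "\<And>g. g \<in> G \<Longrightarrow> l g \<in> borel_measurable M"
    and \<phi>b: "\<And>g z. g \<in> G \<Longrightarrow> z \<in> space M \<Longrightarrow> \<bar>\<phi> g z\<bar> \<le> B"
    and lb: "\<And>g z. g \<in> G \<Longrightarrow> z \<in> space M \<Longrightarrow> \<bar>l g z\<bar> \<le> B"
    and lip: "\<And>g h z. g \<in> G \<Longrightarrow> h \<in> G \<Longrightarrow> z \<in> space M \<Longrightarrow> \<bar>\<phi> g z - \<phi> h z\<bar> \<le> \<bar>l g z - l h z\<bar>"
    and pair_bdd: "\<And>v. v \<in> V \<Longrightarrow> \<exists>C. \<forall>g\<in>G. \<bar>pair v g\<bar> \<le> C"
    and base: "\<And>v g. v \<in> V \<Longrightarrow> g \<in> G \<Longrightarrow> pair v g \<le> \<Psi> 0 v"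
    and step: "\<And>n v z. v \<in> V \<Longrightarrow> z \<in> space M \<Longrightarrow> \<exists>v1\<in>V. \<exists>v2\<in>V.
      (\<forall>g\<in>G. pair v1 g = pair v g + 2 * l g z) \<and> (\<forall>g\<in>G. pair v2 g = pair v g - 2 * l g z) \<and>
      \<Psi> n v1 + \<Psi> n v2 \<le> 2 * \<Psi> (Suc n) v"
    and "v \<in> V"
  shows "(\<integral>S. (SUP g\<in>G. pair v g + (\<Sum>i<n. (\<integral>w. \<phi> g w \<partial>M) - \<phi> g (S i))) \<partial>Pi\<^sub>M {..<n} (\<lambda>_. M)) \<le> \<Psi> n v"
  using \<open>v \<in> V\<close>
proof (induction n arbitrary: v)
  case 0
  interpret P: prob_space "Pi\<^sub>M {..<0::nat} (\<lambda>_. M)" by (rule prob_space_PiM[OF M])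
  have "(SUP g\<in>G. pair v g) \<le> \<Psi> 0 v"
    using G(2) base[OF 0] by (intro cSUP_least) auto
  then show ?case using P.prob_space by simp
next
  case (Suc n)
  let ?P = "Pi\<^sub>M {..<n} (\<lambda>_. M)" and ?Q = "Pi\<^sub>M {..<Suc n} (\<lambda>_. M)"
  interpret M: prob_space M by fact
  interpret P: prob_space ?P by (rule prob_space_PiM[OF M])
  interpret PM: pair_prob_space ?P M ..
  note [measurable] = \<phi>m lm
  define D where "D g z = (\<integral>w. \<phi> g w \<partial>M) - \<phi> g z" for g z
  obtain C where C: "\<And>g. g \<in> G \<Longrightarrow> \<bar>pair v g\<bar> \<le> C" using pair_bdd[OF Suc.prems] by blast
  have [measurable]: "D g \<in> borel_measurable M" if "g \<in> G" for g
    using that unfolding D_def[abs_def] by simp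
  have Pb: "\<bar>\<integral>w. \<phi> g w \<partial>M\<bar> \<le> B" if "g \<in> G" for g
    using that by (intro abs_integral_le_prob[OF M] \<phi>m \<phi>b)
  have Db: "\<bar>D g z\<bar> \<le> 2 * B" if "g \<in> G" "z \<in> space M" for g z
    using Pb[OF that(1)] \<phi>b[OF that] unfolding D_def by linarith
  have sumb: "\<bar>\<Sum>i<k. D g (S i)\<bar> \<le> real k * (2 * B)"
    if "g \<in> G" "S \<in> space (Pi\<^sub>M {..<k} (\<lambda>_. M))" for k g S
  proof -
    have "\<bar>\<Sum>i<k. D g (S i)\<bar> \<le> (\<Sum>i<k. \<bar>D g (S i)\<bar>)" by (rule sum_abs)
    also have "\<dots> \<le> (\<Sum>i<k. 2 * B)"
      using that by (intro sum_mono Db) (auto simp: space_PiM)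
    finally show ?thesis by simp
  qed
  define A where "A S g = pair v g + (\<Sum>i<n. D g (S i))" for S g
  have Ab: "\<bar>A S g\<bar> \<le> C + real n * (2 * B)" if "S \<in> space ?P" "g \<in> G" for S g
    using C[OF that(2)] sumb[OF that(2,1)] unfolding A_def by linarith
  have [measurable]: "(\<lambda>S. A S g) \<in> borel_measurable ?P" if "g \<in> G" for g
    using that unfolding A_def by measurable
  \<comment> \<open>The two signed suprema for the last sample point are \<open>T 2\<close> and
    \<open>T (-2)\<close>; \<open>A\<close> collects the functional \<open>v\<close> and the
    deviations at the first \<open>n\<close> points.\<close>
  define T where "T s p = (SUP g\<in>G. A (fst p) g + s * l g (snd p))" for s :: real and p :: "(nat \<Rightarrow> 'z) \<times> 'z"
  have bT: "\<bar>A S g + s * l g z\<bar> \<le> C + real n * (2 * B) + \<bar>s\<bar> * B"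
    if "S \<in> space ?P" "z \<in> space M" "g \<in> G" for S z g s
  proof -
    have "\<bar>s * l g z\<bar> \<le> \<bar>s\<bar> * B" using lb[OF that(3,2)] by (simp add: abs_mult mult_left_mono)
    then show ?thesis using Ab[OF that(1,3)] by linarith
  qed
  have Tm [measurable]: "T s \<in> borel_measurable (?P \<Otimes>\<^sub>M M)" for s
    unfolding T_def[abs_def] using G
    by (intro borel_measurable_cSUP) (auto simp: space_pair_measure intro!: bdd_above_abs[OF bT])
  have Tb: "\<bar>T s p\<bar> \<le> C + real n * (2 * B) + \<bar>s\<bar> * B" if "p \<in> space (?P \<Otimes>\<^sub>M M)" for s p
    unfolding T_def using that by (intro abs_cSUP_le[OF G(2)] bT) (auto simp: space_pair_measure)
  have intT: "integrable (?P \<Otimes>\<^sub>M M) (T s)" for s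
    by (intro integrable_bounded_prob[OF PM.prob_space_axioms, where B = "C + real n * (2 * B) + \<bar>s\<bar> * B"] Tm Tb)
  have bY: "\<bar>A S g + D g z\<bar> \<le> C + real n * (2 * B) + 2 * B"
    if "S \<in> space ?P" "z \<in> space M" "g \<in> G" for S z g
    using Ab[OF that(1,3)] Db[OF that(3,2)] by linarith
  have intY: "integrable (?P \<Otimes>\<^sub>M M) (\<lambda>(S, z). SUP g\<in>G. A S g + D g z)"
    unfolding case_prod_unfold using G
    by (intro integrable_bounded_prob[OF PM.prob_space_axioms, where B = "C + real n * (2 * B) + 2 * B"]
          borel_measurable_cSUP abs_cSUP_le)
       (auto simp: space_pair_measure intro!: bdd_above_abs[OF bY] bY)
  have intT2: "integrable (?P \<Otimes>\<^sub>M M) (\<lambda>(S, z). (T 2 (S, z) + T (-2) (S, z)) / 2)"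
    using intT[of 2] intT[of "-2"] by (auto simp: case_prod_unfold)
  have bQ: "\<bar>pair v g + (\<Sum>i<Suc n. D g (S i))\<bar> \<le> C + real (Suc n) * (2 * B)"
    if "S \<in> space ?Q" "g \<in> G" for S g
    using C[OF that(2)] sumb[OF that(2,1)] by linarith
  have intQ: "integrable ?Q (\<lambda>S. SUP g\<in>G. pair v g + (\<Sum>i<Suc n. D g (S i)))"
    using G
    by (intro integrable_bounded_prob[OF prob_space_PiM[OF M], where B = "C + real (Suc n) * (2 * B)"]
          borel_measurable_cSUP bdd_above_abs[OF bQ] abs_cSUP_le bQ) auto
  have "(\<integral>S. (SUP g\<in>G. pair v g + (\<Sum>i<Suc n. D g (S i))) \<partial>?Q)
      = (\<integral>S. (\<integral>z. (SUP g\<in>G. A S g + D g z) \<partial>M) \<partial>?P)"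
    unfolding integral_PiM_Suc[OF M intQ] A_def
    by (simp add: add.assoc)
  also have "\<dots> \<le> (\<integral>S. (\<integral>z. (T 2 (S, z) + T (-2) (S, z)) / 2 \<partial>M) \<partial>?P)"
  proof (rule integral_mono_AE)
    show "integrable ?P (\<lambda>S. \<integral>z. (SUP g\<in>G. A S g + D g z) \<partial>M)"
      using PM.integrable_fst[OF intY] .
    show "integrable ?P (\<lambda>S. \<integral>z. (T 2 (S, z) + T (-2) (S, z)) / 2 \<partial>M)"
      using PM.integrable_fst[OF intT2] .
    show "AE S in ?P. (\<integral>z. (SUP g\<in>G. A S g + D g z) \<partial>M) \<le> (\<integral>z. (T 2 (S, z) + T (-2) (S, z)) / 2 \<partial>M)"
    proof (rule AE_I2)
      fix S assume S: "S \<in> space ?P"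
      show "(\<integral>z. (SUP g\<in>G. A S g + D g z) \<partial>M) \<le> (\<integral>z. (T 2 (S, z) + T (-2) (S, z)) / 2 \<partial>M)"
        using symmetrization_step[OF M G \<phi>m lm \<phi>b lb Ab[OF S] lip] unfolding D_def T_def by simp
    qed
  qed
  \<comment> \<open>Exchanging the integrals fixes \<open>z\<close> first, so that its term can be
    absorbed into the functional and the induction hypothesis applied to the remaining
    \<open>n\<close> points.\<close>
  also have "\<dots> = (\<integral>z. (\<integral>S. (T 2 (S, z) + T (-2) (S, z)) / 2 \<partial>?P) \<partial>M)"
    by (rule PM.Fubini_integral[symmetric]) (rule intT2)
  also have "\<dots> \<le> (\<integral>z. \<Psi> (Suc n) v \<partial>M)"
  proof (intro integral_mono)
    show "integrable M (\<lambda>z. \<integral>S. (T 2 (S, z) + T (-2) (S, z)) / 2 \<partial>?P)"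
      using PM.integrable_snd[OF intT2] .
    fix z assume z: "z \<in> space M"
    obtain v1 v2 where v: "v1 \<in> V" "v2 \<in> V"
      "\<And>g. g \<in> G \<Longrightarrow> pair v1 g = pair v g + 2 * l g z"
      "\<And>g. g \<in> G \<Longrightarrow> pair v2 g = pair v g - 2 * l g z"
      "\<Psi> n v1 + \<Psi> n v2 \<le> 2 * \<Psi> (Suc n) v"
      using step[OF Suc.prems z] by blast
    have T1: "T 2 (S, z) = (SUP g\<in>G. pair v1 g + (\<Sum>i<n. D g (S i)))"
      and T2: "T (-2) (S, z) = (SUP g\<in>G. pair v2 g + (\<Sum>i<n. D g (S i)))" for S
      by (auto simp: T_def A_def v(3,4) algebra_simps intro!: SUP_cong)
    have *: "(\<integral>S. T 2 (S, z) \<partial>?P) \<le> \<Psi> n v1" "(\<integral>S. T (-2) (S, z) \<partial>?P) \<le> \<Psi> n v2"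
      unfolding T1 T2 using Suc.IH[OF v(1)] Suc.IH[OF v(2)] by (auto simp: D_def)
    have int: "integrable ?P (\<lambda>S. T s (S, z))" for s
    proof (rule integrable_bounded_prob[OF prob_space_PiM[OF M]])
      show "(\<lambda>S. T s (S, z)) \<in> borel_measurable ?P" using z by measurable
      show "\<bar>T s (S, z)\<bar> \<le> C + real n * (2 * B) + \<bar>s\<bar> * B" if "S \<in> space ?P" for S
        using z that by (intro Tb) (simp add: space_pair_measure)
    qed
    have "(\<integral>S. (T 2 (S, z) + T (-2) (S, z)) / 2 \<partial>?P)
        = ((\<integral>S. T 2 (S, z) \<partial>?P) + (\<integral>S. T (-2) (S, z) \<partial>?P)) / 2"
      using int by simp
    also have "\<dots> \<le> \<Psi> (Suc n) v" using add_mono[OF *] v(5) by simp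
    finally show "(\<integral>S. (T 2 (S, z) + T (-2) (S, z)) / 2 \<partial>?P) \<le> \<Psi> (Suc n) v" .
  qed auto
  finally show ?case by (simp add: D_def M.prob_space)
qed

section \<open>The double ramp loss\<close>

text \<open>A ramp of height 2, falling with slope -1 on [-1, 1]. The height is the origin of the
  factor 2 in the optimal double ramp risk, the slope that of the Lipschitz constant 1.\<close>

definition ramp :: "real \<Rightarrow> real" where
  "ramp u = pos_part (1 - u) - pos_part (- 1 - u)"

lemma ramp_nonneg: "0 \<le> ramp u" and ramp_le_2: "ramp u \<le> 2"
  by (auto simp: ramp_def pos_part_def)

lemma ramp_lipschitz: "\<bar>ramp u - ramp v\<bar> \<le> \<bar>u - v\<bar>"
  by (auto simp: ramp_def pos_part_def)

lemma continuous_on_ramp: "continuous_on UNIV ramp"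
  unfolding ramp_def[abs_def] pos_part_def by (intro continuous_intros)

lemma borel_measurable_ramp [measurable]: "ramp \<in> borel_measurable borel"
  by (intro borel_measurable_continuous_onI continuous_on_ramp)

lemma loss_dr_ramp: "loss_dr d t \<rho> = d * ramp (t - \<rho>) + (1 - d) * ramp (t + \<rho>)"
  by (simp add: loss_dr_def ramp_def algebra_simps)

lemma loss_dr_bounds:
  assumes "0 \<le> d" "d \<le> 1"
  shows "0 \<le> loss_dr d t \<rho>" "loss_dr d t \<rho> \<le> 2"
proof -
  show "0 \<le> loss_dr d t \<rho>"
    using assms ramp_nonneg[of "t - \<rho>"] ramp_nonneg[of "t + \<rho>"] by (simp add: loss_dr_ramp)
  have "d * ramp (t - \<rho>) + (1 - d) * ramp (t + \<rho>) \<le> d * 2 + (1 - d) * 2"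
    using assms by (intro add_mono mult_left_mono ramp_le_2) auto
  then show "loss_dr d t \<rho> \<le> 2" by (simp add: loss_dr_ramp)
qed

text \<open>The loss decreases in the margin with slope at most 1 in modulus, so only a deficit of
  margin is charged. This one-sided form is what matches the hinge penalty of the
  projection.\<close>

lemma loss_dr_le_add_pos_part:
  assumes "0 \<le> d" "d \<le> 1"
  shows "loss_dr d t \<rho> \<le> loss_dr d s \<rho> + max 0 (s - t)"
proof -
  have *: "ramp (t + c) \<le> ramp (s + c) + max 0 (s - t)" for c
    by (auto simp: ramp_def pos_part_def)
  have "d * ramp (t - \<rho>) + (1 - d) * ramp (t + \<rho>)
      \<le> d * (ramp (s - \<rho>) + max 0 (s - t)) + (1 - d) * (ramp (s + \<rho>) + max 0 (s - t))"
    using assms *[of "- \<rho>"] *[of \<rho>] by (intro add_mono mult_left_mono) auto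
  then show ?thesis by (simp add: loss_dr_ramp algebra_simps)
qed

lemma xi_eq_min:
  assumes "d < 1 / 2"
  shows "xi d e = min e (min d (1 - e))"
  using assms by (auto simp: xi_def)

lemma ramp_eq:
  "1 \<le> u \<Longrightarrow> ramp u = 0" "u \<le> - 1 \<Longrightarrow> ramp u = 2"
  "- 1 \<le> u \<Longrightarrow> u \<le> 1 \<Longrightarrow> ramp u = 1 - u"
  by (auto simp: ramp_def pos_part_def)

text \<open>For a nonnegative margin the gap between the two conditional risks is \<open>d\<close>
  below \<rho> - 1 and \<open>1 - e\<close> from \<rho> + 1 on. It moves linearly from
  \<open>d\<close> to \<open>1 - e\<close> on the interval from \<rho> - 1 to \<rho>, and once more
  on the one from \<rho> to \<rho> + 1, restarting at \<rho> where the reject-option loss jumps. The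
  bound \<open>1 \<le> \<rho>\<close> keeps the ramp at \<open>z + \<rho>\<close> equal to zero
  throughout.\<close>

lemma cond_loss_dr_ge:
  assumes "0 < d" "d < 1 / 2" "1 \<le> \<rho>"
  shows "e * loss_d d z \<rho> + (1 - e) * loss_d d (- z) \<rho> + min e (min d (1 - e))
    \<le> e * loss_dr d z \<rho> + (1 - e) * loss_dr d (- z) \<rho>"
proof -
  let ?m = "min e (min d (1 - e))"
  have m: "?m \<le> e" "?m \<le> d" "?m \<le> 1 - e" by auto
  \<comment> \<open>Stated for arbitrary \<open>e\<close>, \<open>z\<close> and any \<open>m\<close>
    below all three costs: a negative margin is then the same claim with \<open>e\<close> and
    \<open>z\<close> replaced by \<open>1 - e\<close> and \<open>- z\<close>.\<close>
  have *: "e * loss_d d z \<rho> + (1 - e) * loss_d d (- z) \<rho> + m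
    \<le> e * loss_dr d z \<rho> + (1 - e) * loss_dr d (- z) \<rho>"
    if m: "m \<le> e" "m \<le> d" "m \<le> 1 - e" and z: "0 \<le> z" for e z m
  proof -
    consider "z \<ge> \<rho> + 1" | "\<rho> < z" "z < \<rho> + 1" | "\<rho> - 1 \<le> z" "z \<le> \<rho>" | "z < \<rho> - 1"
      by linarith
    then show ?thesis
    proof cases
      case 1
      then have L: "loss_dr d z \<rho> = 0" "loss_dr d (- z) \<rho> = 2"
        "loss_d d z \<rho> = 0" "loss_d d (- z) \<rho> = 1"
        using assms by (auto simp: loss_dr_ramp loss_d_def ramp_eq(1,2))
      show ?thesis using m unfolding L by (simp add: algebra_simps)
    next
      case 2
      define s where "s = z - \<rho>"
      have "ramp (z - \<rho>) = 1 - s" "ramp (z + \<rho>) = 0" "ramp (- z - \<rho>) = 2" "ramp (- z + \<rho>) = 1 + s"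
        using 2 assms by (auto simp: s_def ramp_eq)
      then have L: "loss_dr d z \<rho> = d * (1 - s)" "loss_dr d (- z) \<rho> = d * 2 + (1 - d) * (1 + s)"
        unfolding loss_dr_ramp by simp_all
      have L': "loss_d d z \<rho> = 0" "loss_d d (- z) \<rho> = 1"
        using 2 assms by (auto simp: loss_d_def)
      have "0 \<le> (1 - s) * (d - m) + s * (1 - e - m)"
        using 2 m by (intro add_nonneg_nonneg mult_nonneg_nonneg) (auto simp: s_def)
      then show ?thesis unfolding L L' by (simp add: algebra_simps)
    next
      case 3
      define s where "s = z - \<rho> + 1"
      have "ramp (z - \<rho>) = 2 - s" "ramp (z + \<rho>) = 0" "ramp (- z - \<rho>) = 2" "ramp (- z + \<rho>) = s"
        using 3 assms by (auto simp: s_def ramp_eq)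
      then have L: "loss_dr d z \<rho> = d * (2 - s)" "loss_dr d (- z) \<rho> = d * 2 + (1 - d) * s"
        unfolding loss_dr_ramp by simp_all
      have L': "loss_d d z \<rho> = d" "loss_d d (- z) \<rho> = d"
        using 3 z assms by (auto simp: loss_d_def)
      have "0 \<le> (1 - s) * (d - m) + s * (1 - e - m)"
        using 3 m by (intro add_nonneg_nonneg mult_nonneg_nonneg) (auto simp: s_def)
      then show ?thesis unfolding L L' by (simp add: algebra_simps)
    next
      case 4
      then have L: "loss_dr d z \<rho> = d * 2" "loss_dr d (- z) \<rho> = d * 2"
        using z assms by (auto simp: loss_dr_ramp ramp_eq)
      have L': "loss_d d z \<rho> = d" "loss_d d (- z) \<rho> = d"
        using 4 z assms by (auto simp: loss_d_def)
      show ?thesis using m unfolding L L' by (simp add: algebra_simps)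
    qed
  qed
  show ?thesis
  proof (cases "0 \<le> z")
    case True
    then show ?thesis using * m by blast
  next
    case False
    then show ?thesis using *[of ?m "1 - e" "- z"] m by simp
  qed
qed

lemma cond_loss_d_ge:
  assumes "0 < d" "d < 1 / 2" "0 \<le> \<rho>"
  shows "min e (min d (1 - e)) \<le> e * loss_d d z \<rho> + (1 - e) * loss_d d (- z) \<rho>"
  using assms by (auto simp: loss_d_def of_bool_def algebra_simps split: if_splits)

text \<open>The lower bound adds the two preceding inequalities, each of which contributes one copy
  of the minimum.\<close>

lemma cond_opt_dr_eq:
  assumes "0 < d" "d < 1 / 2"
  shows "cond_opt_dr d e = 2 * min e (min d (1 - e))"
  unfolding cond_opt_dr_def
proof (rule cInf_eq_minimum)
  let ?f = "\<lambda>(z, \<rho>). e * loss_dr d z \<rho> + (1 - e) * loss_dr d (- z) \<rho>"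
  \<comment> \<open>With \<rho> = 1, the margins -2, 2 and 0 put both ramps at extreme values; they
    predict -1, predict 1 and reject, and one of them is optimal.\<close>
  have "?f (-2, 1) = 2 * e" "?f (2, 1) = 2 * (1 - e)" "?f (0, 1) = 2 * d"
    by (simp_all add: loss_dr_ramp ramp_eq algebra_simps)
  moreover have "min e (min d (1 - e)) = e \<or> min e (min d (1 - e)) = d \<or> min e (min d (1 - e)) = 1 - e"
    by (auto simp: min_def)
  ultimately have "2 * min e (min d (1 - e)) \<in> ?f ` {(-2, 1), (2, 1), (0, 1)}"
    by auto
  then show "2 * min e (min d (1 - e)) \<in> ?f ` (UNIV \<times> {1..})"
    by (rule subsetD[OF image_mono, rotated]) auto
next
  fix u assume "u \<in> (\<lambda>(z, \<rho>). e * loss_dr d z \<rho> + (1 - e) * loss_dr d (- z) \<rho>) ` (UNIV \<times> {1..})"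
  then obtain z \<rho> where u: "1 \<le> \<rho>" "u = e * loss_dr d z \<rho> + (1 - e) * loss_dr d (- z) \<rho>" by auto
  have "min e (min d (1 - e)) + min e (min d (1 - e)) \<le> u"
    unfolding u(2)
    by (rule order_trans[OF add_right_mono cond_loss_dr_ge[OF assms u(1)]])
       (use u(1) in \<open>intro cond_loss_d_ge[OF assms], simp\<close>)
  then show "2 * min e (min d (1 - e)) \<le> u" by simp
qed

section \<open>Kernel expansions in the reproducing kernel Hilbert space\<close>

context rkhs
begin

abbreviation nrm :: "('a \<Rightarrow> real) \<Rightarrow> real" where
  "nrm \<equiv> ip_norm ip"

lemma nrm_nonneg: "f \<in> H \<Longrightarrow> 0 \<le> nrm f"
  by (simp add: ip_norm_def ip_nonneg)

lemma nrm_power2: "f \<in> H \<Longrightarrow> (nrm f)\<^sup>2 = ip f f"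
  by (simp add: ip_norm_def ip_nonneg)

lemma ip_add_right: "f \<in> H \<Longrightarrow> g \<in> H \<Longrightarrow> h \<in> H \<Longrightarrow> ip h (\<lambda>x. f x + g x) = ip h f + ip h g"
  by (simp only: ip_commute[of h "\<lambda>x. f x + g x"] ip_commute[of h f] ip_commute[of h g] add_mem ip_add)

lemma ip_scale_right: "f \<in> H \<Longrightarrow> g \<in> H \<Longrightarrow> ip g (\<lambda>x. c * f x) = c * ip g f"
  by (simp only: ip_commute[of g "\<lambda>x. c * f x"] ip_commute[of g f] scale_mem ip_scale)

lemma ip_zero: "f \<in> H \<Longrightarrow> ip (\<lambda>_. 0) f = 0"
  using ip_scale[of f f 0] by simp

lemma ip_add_scale_self:
  assumes "f \<in> H" "g \<in> H"
  shows "ip (\<lambda>x. f x + c * g x) (\<lambda>x. f x + c * g x) = ip f f + 2 * c * ip f g + c\<^sup>2 * ip g g"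
proof -
  note m = assms scale_mem[OF assms(2), of c] add_mem[OF assms(1) scale_mem[OF assms(2), of c]]
  have "ip (\<lambda>x. f x + c * g x) (\<lambda>x. f x + c * g x)
      = ip f (\<lambda>x. f x + c * g x) + ip (\<lambda>x. c * g x) (\<lambda>x. f x + c * g x)"
    using m by (intro ip_add)
  also have "ip f (\<lambda>x. f x + c * g x) = ip f f + c * ip f g"
    using m by (simp add: ip_add_right ip_scale_right)
  also have "ip (\<lambda>x. c * g x) (\<lambda>x. f x + c * g x) = c * (ip g f + c * ip g g)"
    using m by (simp add: ip_scale ip_add_right ip_scale_right)
  finally show ?thesis
    using ip_commute[OF assms] by (simp add: power2_eq_square algebra_simps)
qed

lemma cauchy_schwarz:
  assumes "f \<in> H" "g \<in> H"
  shows "\<bar>ip f g\<bar> \<le> nrm f * nrm g"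
proof (cases "ip g g = 0")
  case True
  then have "g = (\<lambda>_. 0)" using ip_definite assms by blast
  then show ?thesis using assms ip_zero ip_commute[of f g] by (simp add: ip_norm_def)
next
  case False
  then have pos: "0 < ip g g" using ip_nonneg[OF assms(2)] by simp
  have "0 \<le> ip f f + 2 * (- ip f g / ip g g) * ip f g + (- ip f g / ip g g)\<^sup>2 * ip g g"
    unfolding ip_add_scale_self[OF assms, symmetric]
    using assms by (intro ip_nonneg add_mem scale_mem)
  also have "\<dots> = ip f f - (ip f g)\<^sup>2 / ip g g"
    using pos by (simp add: power2_eq_square field_simps)
  finally have "(ip f g)\<^sup>2 \<le> ip f f * ip g g"
    using pos by (simp add: field_simps)
  then have "sqrt ((ip f g)\<^sup>2) \<le> sqrt (ip f f * ip g g)" by (rule real_sqrt_le_mono)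
  then show ?thesis by (simp add: ip_norm_def real_sqrt_mult)
qed

lemma ip_le_half_sum:
  assumes "f \<in> H" "g \<in> H"
  shows "ip f g \<le> (ip f f + ip g g) / 2"
proof -
  have "0 \<le> ip f f + 2 * (-1) * ip f g + (-1)\<^sup>2 * ip g g"
    unfolding ip_add_scale_self[OF assms, symmetric]
    using assms by (intro ip_nonneg add_mem scale_mem)
  then show ?thesis by simp
qed

lemma sum_mem: "(\<And>i. i \<in> I \<Longrightarrow> f i \<in> H) \<Longrightarrow> (\<lambda>x. \<Sum>i\<in>I. f i x) \<in> H"
  by (induction I rule: infinite_finite_induct) (auto simp: zero_mem intro!: add_mem)

lemma ip_sum_left:
  assumes "\<And>i. i \<in> I \<Longrightarrow> f i \<in> H" "g \<in> H"
  shows "ip (\<lambda>x. \<Sum>i\<in>I. f i x) g = (\<Sum>i\<in>I. ip (f i) g)"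
  using assms
proof (induction I rule: infinite_finite_induct)
  case (insert i I)
  then show ?case using ip_add[of "f i" "\<lambda>x. \<Sum>i\<in>I. f i x" g] sum_mem[of I f] by simp
qed (auto simp: ip_zero)

lemma section_ip_self: "x \<in> X \<Longrightarrow> ip (kernel_section X K x) (kernel_section X K x) = K x x"
  using reproducing[OF section_mem] by (simp add: kernel_section_def)

lemma nrm_section: "x \<in> X \<Longrightarrow> nrm (kernel_section X K x) = sqrt (K x x)"
  by (simp add: ip_norm_def section_ip_self)

lemma abs_eval_le: "f \<in> H \<Longrightarrow> x \<in> X \<Longrightarrow> \<bar>f x\<bar> \<le> nrm f * sqrt (K x x)"
  using cauchy_schwarz[OF _ section_mem, of f x] by (simp add: reproducing nrm_section)

lemma expansion_mem:
  "(\<And>i. i < n \<Longrightarrow> x i \<in> X) \<Longrightarrow> (\<lambda>t. \<Sum>i<n. c i * kernel_section X K (x i) t) \<in> H"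
  by (intro sum_mem scale_mem section_mem) auto

lemma ip_expansion:
  assumes "\<And>i. i < n \<Longrightarrow> x i \<in> X" "f \<in> H"
  shows "ip (\<lambda>t. \<Sum>i<n. c i * kernel_section X K (x i) t) f = (\<Sum>i<n. c i * f (x i))"
proof -
  have "ip (\<lambda>t. c i * kernel_section X K (x i) t) f = c i * f (x i)" if "i < n" for i
    using that assms ip_scale[OF section_mem] ip_commute[OF section_mem]
    by (simp add: reproducing)
  then show ?thesis
    using assms by (subst ip_sum_left) (auto intro!: scale_mem section_mem)
qed

text \<open>Pairing \<open>h\<close> with itself and evaluating at the centres gives |h|^2 <= |h|
  tau sum |c_i|, and one factor of the norm cancels.\<close>

lemma nrm_expansion_le:
  assumes x: "\<And>i. i < n \<Longrightarrow> x i \<in> X" and K: "\<And>x. x \<in> X \<Longrightarrow> K x x \<le> \<tau>\<^sup>2" and "0 \<le> \<tau>"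
  shows "nrm (\<lambda>t. \<Sum>i<n. c i * kernel_section X K (x i) t) \<le> \<tau> * (\<Sum>i<n. \<bar>c i\<bar>)"
proof -
  let ?h = "\<lambda>t. \<Sum>i<n. c i * kernel_section X K (x i) t"
  have h: "?h \<in> H" using x by (rule expansion_mem)
  have "(nrm ?h)\<^sup>2 = (\<Sum>i<n. c i * ?h (x i))"
    by (simp only: nrm_power2[OF h] ip_expansion[OF x h])
  also have "\<dots> \<le> (\<Sum>i<n. \<bar>c i\<bar> * (nrm ?h * \<tau>))"
  proof (intro sum_mono)
    fix i assume "i \<in> {..<n}"
    then have xi: "x i \<in> X" using x by simp
    have "sqrt (K (x i) (x i)) \<le> \<tau>" using K[OF xi] \<open>0 \<le> \<tau>\<close> by (simp add: real_le_lsqrt)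
    then have "\<bar>?h (x i)\<bar> \<le> nrm ?h * \<tau>"
      using abs_eval_le[OF h xi] mult_left_mono[OF _ nrm_nonneg[OF h], of "sqrt (K (x i) (x i))" \<tau>]
      by linarith
    then have "\<bar>c i\<bar> * \<bar>?h (x i)\<bar> \<le> \<bar>c i\<bar> * (nrm ?h * \<tau>)" by (rule mult_left_mono) simp
    then have "\<bar>c i * ?h (x i)\<bar> \<le> \<bar>c i\<bar> * (nrm ?h * \<tau>)" unfolding abs_mult .
    then show "c i * ?h (x i) \<le> \<bar>c i\<bar> * (nrm ?h * \<tau>)" by linarith
  qed
  also have "\<dots> = nrm ?h * (\<tau> * (\<Sum>i<n. \<bar>c i\<bar>))"
    by (simp add: sum_distrib_right[symmetric])
  finally have *: "nrm ?h * nrm ?h \<le> nrm ?h * (\<tau> * (\<Sum>i<n. \<bar>c i\<bar>))"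
    unfolding power2_eq_square .
  have "0 \<le> \<tau> * (\<Sum>i<n. \<bar>c i\<bar>)" using \<open>0 \<le> \<tau>\<close> by (intro mult_nonneg_nonneg sum_nonneg) auto
  moreover have "a \<le> b" if "a * a \<le> a * b" "0 \<le> a" "0 \<le> b" for a b :: real
    using that by (cases "a = 0") auto
  ultimately show ?thesis using * nrm_nonneg[OF h] by blast
qed

end

section \<open>Continuity and measurability of functions in the RKHS\<close>

lemma abs_diff_eval_le:
  assumes "rkhs X K H ip" "h \<in> H" "x \<in> X" "y \<in> X"
  shows "\<bar>h y - h x\<bar> \<le> ip_norm ip h * sqrt (K y y - 2 * K y x + K x x)"
proof -
  interpret rkhs X K H ip by fact
  let ?kx = "kernel_section X K x" and ?ky = "kernel_section X K y"
  let ?D = "\<lambda>t. ?ky t + (- 1) * ?kx t"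
  have m: "?kx \<in> H" "?ky \<in> H" using assms section_mem by auto
  have D: "?D \<in> H" using m by (intro add_mem scale_mem)
  have "ip h ?D = h y - h x"
    using assms m ip_add_right[OF m(2) scale_mem[OF m(1)] assms(2), of "- 1"]
      ip_scale_right[OF m(1) assms(2), of "- 1"] reproducing[OF assms(2)] by simp
  moreover have "ip ?D ?D = K y y - 2 * K y x + K x x"
    using assms reproducing[OF m(2) assms(3)]
    by (simp only: ip_add_scale_self[OF m(2,1)] section_ip_self) (simp add: kernel_section_def)
  ultimately show ?thesis
    using cauchy_schwarz[OF assms(2) D] by (simp add: ip_norm_def)
qed

text \<open>\<open>h\<close> is Lipschitz, with its norm as constant, for the distance between
  kernel sections; that distance tends to 0 as y tends to x because the kernel is jointly
  continuous.\<close>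

lemma continuous_on_rkhs_mem:
  fixes X :: "'a::topological_space set"
  assumes r: "rkhs X K H ip" and K: "mercer_kernel X K" and h: "h \<in> H"
  shows "continuous_on X h"
  unfolding continuous_on_def
proof
  fix x assume x: "x \<in> X"
  have cK: "continuous_on (X \<times> X) (\<lambda>(x, y). K x y)" using K by (simp add: mercer_kernel_def)
  have "continuous_on X (\<lambda>y. case (y, y) of (s, t) \<Rightarrow> K s t)"
    by (rule continuous_on_compose2[OF cK]) (auto intro!: continuous_intros)
  moreover have "continuous_on X (\<lambda>y. case (y, x) of (s, t) \<Rightarrow> K s t)"
    using x by (intro continuous_on_compose2[OF cK]) (auto intro!: continuous_intros)
  ultimately have "continuous_on X (\<lambda>y. K y y - 2 * K y x + K x x)"
    by (auto intro!: continuous_intros)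
  then have "((\<lambda>y. K y y - 2 * K y x + K x x) \<longlongrightarrow> K x x - 2 * K x x + K x x) (at x within X)"
    using x by (auto simp: continuous_on_def)
  then have "((\<lambda>y. ip_norm ip h * sqrt (K y y - 2 * K y x + K x x)) \<longlongrightarrow> ip_norm ip h * sqrt 0) (at x within X)"
    by (intro tendsto_intros) simp
  then have *: "((\<lambda>y. ip_norm ip h * sqrt (K y y - 2 * K y x + K x x)) \<longlongrightarrow> 0) (at x within X)"
    by simp
  have "\<forall>\<^sub>F y in at x within X. norm (h y - h x) \<le> ip_norm ip h * sqrt (K y y - 2 * K y x + K x x)"
    using abs_diff_eval_le[OF r h x] by (auto simp: eventually_at_filter)
  then have "((\<lambda>y. h y - h x) \<longlongrightarrow> 0) (at x within X)"
    by (rule Lim_null_comparison[OF _ *])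
  then show "(h \<longlongrightarrow> h x) (at x within X)"
    by (simp add: LIM_zero_iff)
qed

lemma labelled_distributionD:
  assumes "labelled_distribution X D"
  shows "prob_space D" "space D = X \<times> {-1, 1}"
    "fst \<in> D \<rightarrow>\<^sub>M restrict_space borel X" "snd \<in> borel_measurable D"
proof -
  have s: "sets D = sets (restrict_space borel X \<Otimes>\<^sub>M count_space {-1, 1})"
    using assms by (simp add: labelled_distribution_def)
  show "prob_space D" using assms by (simp add: labelled_distribution_def)
  show "space D = X \<times> {-1, 1}"
    using sets_eq_imp_space_eq[OF s] by (simp add: space_pair_measure space_restrict_space)
  show "fst \<in> D \<rightarrow>\<^sub>M restrict_space borel X"
    using measurable_fst by (simp add: measurable_cong_sets[OF s refl])
  have "snd \<in> D \<rightarrow>\<^sub>M count_space {-1, 1::real}"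
    using measurable_snd by (simp add: measurable_cong_sets[OF s refl])
  from measurable_compose[OF this, of id borel] show "snd \<in> borel_measurable D"
    by simp
qed

lemma borel_measurable_rkhs_fst:
  assumes "labelled_distribution X D" "rkhs X K H ip" "mercer_kernel X K" "h \<in> H"
  shows "(\<lambda>z. h (fst z)) \<in> borel_measurable D"
  using labelled_distributionD(3)[OF assms(1)]
    borel_measurable_continuous_on_restrict[OF continuous_on_rkhs_mem[OF assms(2-4)]]
  by (rule measurable_compose)

section \<open>Expected deviation over bounded kernel expansions\<close>

lemma sqrt_add_sqrt_le:
  assumes "0 \<le> a" "0 \<le> b" "a + b \<le> 2 * c"
  shows "sqrt a + sqrt b \<le> 2 * sqrt c"
proof -
  have "(sqrt a + sqrt b)\<^sup>2 \<le> 2 * (a + b)"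
    using sum_squares_bound[of "sqrt a" "sqrt b"] assms by (simp add: power2_sum)
  also have "\<dots> \<le> 4 * c" using assms by simp
  finally have "sqrt a + sqrt b \<le> sqrt (4 * c)" by (rule real_le_rsqrt)
  also have "\<dots> = 2 * sqrt c" by (simp add: real_sqrt_mult)
  finally show ?thesis .
qed

type_synonym 'a shifted_expansion = "(nat \<Rightarrow> real) \<times> (nat \<Rightarrow> 'a) \<times> real \<times> real"

definition expansion ::
  "'a set \<Rightarrow> ('a \<Rightarrow> 'a \<Rightarrow> real) \<Rightarrow> nat \<Rightarrow> 'a shifted_expansion \<Rightarrow> 'a \<Rightarrow> real" where
  "expansion X K n = (\<lambda>(c, x, p, q) t. \<Sum>i<n. c i * kernel_section X K (x i) t)"

text \<open>The margin \<open>y h(x)\<close> shifted by a label-dependent offset. Both ramps of the double ramp loss at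
  \<open>(h + b, \<rho>)\<close> have this shape, with offsets \<open>(b - \<rho>, - b - \<rho>)\<close> and \<open>(b + \<rho>, - b + \<rho>)\<close>.\<close>

definition shifted_margin ::
  "'a set \<Rightarrow> ('a \<Rightarrow> 'a \<Rightarrow> real) \<Rightarrow> nat \<Rightarrow> 'a shifted_expansion \<Rightarrow> 'a \<times> real \<Rightarrow> real" where
  "shifted_margin X K n = (\<lambda>\<theta> z. snd z * expansion X K n \<theta> (fst z)
     + (if snd z = 1 then fst (snd (snd \<theta>)) else snd (snd (snd \<theta>))))"

text \<open>The centres range over all of \<open>X\<close> and not over sample points, which makes
  the class independent of the sample. Coefficients and centres are total sequences, so the class
  lies in a second countable product space and has a countable dense subset.\<close>

definition expansion_params :: "'a set \<Rightarrow> nat \<Rightarrow> real \<Rightarrow> real \<Rightarrow> 'a shifted_expansion set" where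
  "expansion_params X n r b =
     {(c, x, p, q). (\<forall>i. x i \<in> X) \<and> (\<Sum>i<n. \<bar>c i\<bar>) \<le> r \<and> \<bar>p\<bar> \<le> b \<and> \<bar>q\<bar> \<le> b}"

locale bounded_kernel_sample = rkhs X K H ip
  for X :: "'a::{metric_space, second_countable_topology} set" and K H ip +
  fixes D :: "('a \<times> real) measure" and \<tau> :: real
  assumes dist: "labelled_distribution X D"
    and mercer: "mercer_kernel X K"
    and \<tau>: "0 \<le> \<tau>" "\<And>x. x \<in> X \<Longrightarrow> K x x \<le> \<tau>\<^sup>2"
begin

lemmas prob_D = labelled_distributionD(1)[OF dist]
  and space_D = labelled_distributionD(2)[OF dist]
  and snd_measurable [measurable] = labelled_distributionD(4)[OF dist]
  and mem_measurable = borel_measurable_rkhs_fst[OF dist rkhs_axioms mercer]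

lemma expansion_in_H: "\<theta> \<in> expansion_params X n r b \<Longrightarrow> expansion X K n \<theta> \<in> H"
  by (auto simp: expansion_def expansion_params_def intro!: expansion_mem)

lemma nrm_expansion_params:
  assumes "\<theta> \<in> expansion_params X n r b"
  shows "nrm (expansion X K n \<theta>) \<le> \<tau> * r"
proof -
  obtain c x p q where \<theta>: "\<theta> = (c, x, p, q)" by (cases \<theta>)
  with assms have x: "\<And>i. i < n \<Longrightarrow> x i \<in> X" "(\<Sum>i<n. \<bar>c i\<bar>) \<le> r"
    by (auto simp: expansion_params_def)
  have "nrm (expansion X K n \<theta>) \<le> \<tau> * (\<Sum>i<n. \<bar>c i\<bar>)"
    unfolding expansion_def \<theta> prod.case by (rule nrm_expansion_le[OF x(1) \<tau>(2,1)])
  also have "\<dots> \<le> \<tau> * r" by (rule mult_left_mono[OF x(2) \<tau>(1)])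
  finally show ?thesis .
qed

lemma abs_expansion_le:
  assumes "\<theta> \<in> expansion_params X n r b" "t \<in> X"
  shows "\<bar>expansion X K n \<theta> t\<bar> \<le> \<tau>\<^sup>2 * r"
proof -
  have "\<bar>expansion X K n \<theta> t\<bar> \<le> nrm (expansion X K n \<theta>) * sqrt (K t t)"
    by (rule abs_eval_le[OF expansion_in_H[OF assms(1)] assms(2)])
  also have "\<dots> \<le> (\<tau> * r) * \<tau>"
    using \<tau> nrm_expansion_params[OF assms(1)] nrm_nonneg[OF expansion_in_H[OF assms(1)]]
      section_ip_self[OF assms(2)] ip_nonneg[OF section_mem[OF assms(2)]] assms(2)
    by (intro mult_mono real_le_lsqrt) auto
  finally show ?thesis by (simp add: power2_eq_square algebra_simps)
qed

lemma shifted_margin_measurable: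
  "\<theta> \<in> expansion_params X n r b \<Longrightarrow> shifted_margin X K n \<theta> \<in> borel_measurable D"
  unfolding shifted_margin_def using mem_measurable[OF expansion_in_H[of \<theta> n r b]]
  by (auto intro!: borel_measurable_add borel_measurable_times measurable_If)

lemma abs_shifted_margin_le:
  assumes "\<theta> \<in> expansion_params X n r b" "z \<in> space D"
  shows "\<bar>shifted_margin X K n \<theta> z\<bar> \<le> \<tau>\<^sup>2 * r + b"
proof -
  have z: "fst z \<in> X" "snd z = 1 \<or> snd z = - 1" using assms(2) unfolding space_D by auto
  have "\<bar>fst (snd (snd \<theta>))\<bar> \<le> b" "\<bar>snd (snd (snd \<theta>))\<bar> \<le> b"
    using assms(1) by (auto simp: expansion_params_def)
  then show ?thesis using abs_expansion_le[OF assms(1) z(1)] z(2)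
    by (auto simp: shifted_margin_def)
qed

text \<open>The inner product of H x R x R between a triple \<open>v\<close> and the triple formed
  by the expansion and its two offsets. In these terms \<open>shifted_margin\<close> at a point is
  the pairing with a fixed feature vector, and \<open>sqnorm\<close> is the squared norm of
  \<open>v\<close>.\<close>

definition pairing :: "('a \<Rightarrow> real) \<times> real \<times> real \<Rightarrow> nat \<Rightarrow> 'a shifted_expansion \<Rightarrow> real" where
  "pairing = (\<lambda>(w, a, a') n \<theta>. ip w (expansion X K n \<theta>) + a * fst (snd (snd \<theta>)) + a' * snd (snd (snd \<theta>)))"

definition sqnorm :: "('a \<Rightarrow> real) \<times> real \<times> real \<Rightarrow> real" where
  "sqnorm = (\<lambda>(w, a, a'). ip w w + a\<^sup>2 + a'\<^sup>2)"

lemma abs_pairing_le: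
  assumes "fst v \<in> H" "\<theta> \<in> expansion_params X n r b" "0 \<le> b"
  shows "\<bar>pairing v n \<theta>\<bar> \<le> (\<tau> * r + 2 * b) * sqrt (sqnorm v)"
proof -
  obtain w a a' where v: "v = (w, a, a')" by (cases v)
  obtain c x p q where \<theta>: "\<theta> = (c, x, p, q)" by (cases \<theta>)
  have w: "w \<in> H" using assms(1) v by simp
  have b: "\<bar>p\<bar> \<le> b" "\<bar>q\<bar> \<le> b" using assms(2) \<theta> by (auto simp: expansion_params_def)
  let ?s = "sqrt (sqnorm v)"
  have s: "nrm w \<le> ?s" "\<bar>a\<bar> \<le> ?s" "\<bar>a'\<bar> \<le> ?s" "0 \<le> ?s"
    using ip_nonneg[OF w]
    by (auto simp: sqnorm_def v ip_norm_def intro!: real_le_rsqrt)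
  have "\<bar>ip w (expansion X K n \<theta>)\<bar> \<le> nrm w * nrm (expansion X K n \<theta>)"
    by (rule cauchy_schwarz[OF w expansion_in_H[OF assms(2)]])
  also have "\<dots> \<le> ?s * (\<tau> * r)"
    using s nrm_nonneg[OF w] nrm_nonneg[OF expansion_in_H[OF assms(2)]] nrm_expansion_params[OF assms(2)]
    by (intro mult_mono) auto
  finally have "\<bar>ip w (expansion X K n \<theta>)\<bar> \<le> ?s * (\<tau> * r)" .
  moreover have "\<bar>a * p\<bar> \<le> ?s * b" "\<bar>a' * q\<bar> \<le> ?s * b"
    using s b unfolding abs_mult by (auto intro!: mult_mono)
  ultimately have "\<bar>ip w (expansion X K n \<theta>) + a * p + a' * q\<bar> \<le> ?s * (\<tau> * r) + ?s * b + ?s * b"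
    by linarith
  then show ?thesis by (simp add: pairing_def v \<theta> algebra_simps)
qed

text \<open>\<open>v1\<close> and \<open>v2\<close> are \<open>v\<close> plus and minus twice the
  feature vector of \<open>z\<close>. In the sum of the squared norms the cross terms cancel; what
  is added to 2 \<open>sqnorm v\<close> is 8 times the squared norm K x x + 1 of the feature
  vector.\<close>

lemma sqnorm_step:
  assumes v: "fst v \<in> H" and z: "z \<in> space D"
  obtains v1 v2 where "fst v1 \<in> H" "fst v2 \<in> H"
    "\<And>n r b \<theta>. \<theta> \<in> expansion_params X n r b \<Longrightarrow> pairing v1 n \<theta> = pairing v n \<theta> + 2 * shifted_margin X K n \<theta> z"
    "\<And>n r b \<theta>. \<theta> \<in> expansion_params X n r b \<Longrightarrow> pairing v2 n \<theta> = pairing v n \<theta> - 2 * shifted_margin X K n \<theta> z"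
    "sqnorm v1 + sqnorm v2 \<le> 2 * sqnorm v + 8 * (\<tau>\<^sup>2 + 1)"
proof -
  obtain w a a' where ve: "v = (w, a, a')" by (cases v)
  obtain x y where ze: "z = (x, y)" by (cases z)
  have w: "w \<in> H" using v ve by simp
  have xy: "x \<in> X" "y = 1 \<or> y = - 1" using z unfolding space_D ze by auto
  let ?k = "kernel_section X K x"
  note k = section_mem[OF xy(1)]
  define e e' :: real where "e = (if y = 1 then 1 else 0)" and "e' = (if y = 1 then 0 else 1)"
  \<comment> \<open>\<open>u\<close> is indexed by the coefficient of the kernel section; at
    \<open>s * (2 * y)\<close> it is \<open>v\<close> plus \<open>2 * s\<close> times the feature
    vector, whose components are the section times y, \<open>e\<close> and
    \<open>e'\<close>.\<close>
  define u where "u s = ((\<lambda>t. w t + s * ?k t), a + 2 * (s / (2 * y)) * e, a' + 2 * (s / (2 * y)) * e')" for s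
  have u: "fst (u s) \<in> H" for s
    using w k by (simp add: u_def add_mem scale_mem)
  have pair: "pairing (u (s * (2 * y))) n \<theta> = pairing v n \<theta> + 2 * s * shifted_margin X K n \<theta> z"
    if "\<theta> \<in> expansion_params X n r b" for s n r b \<theta>
  proof -
    note E = expansion_in_H[OF that]
    have "ip (\<lambda>t. w t + (s * (2 * y)) * ?k t) (expansion X K n \<theta>)
        = ip w (expansion X K n \<theta>) + (s * (2 * y)) * expansion X K n \<theta> x"
      using ip_add[OF w scale_mem[OF k] E] ip_scale[OF k E] ip_commute[OF k E] reproducing[OF E xy(1)]
      by simp
    then show ?thesis using xy(2)
      by (auto simp: pairing_def u_def ve ze shifted_margin_def e_def e'_def algebra_simps)
  qed
  have sq: "sqnorm (u (s * (2 * y))) = sqnorm v + 4 * s * (y * ip w ?k + a * e + a' * e') + 4 * s\<^sup>2 * (K x x + 1)" for s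
    using xy(2) unfolding u_def sqnorm_def ve prod.case ip_add_scale_self[OF w k] section_ip_self[OF xy(1)]
    by (auto simp: e_def e'_def power2_eq_square algebra_simps)
  show ?thesis
  proof (rule that[of "u (1 * (2 * y))" "u ((- 1) * (2 * y))"])
    show "sqnorm (u (1 * (2 * y))) + sqnorm (u ((- 1) * (2 * y))) \<le> 2 * sqnorm v + 8 * (\<tau>\<^sup>2 + 1)"
      unfolding sq using \<tau>(2)[OF xy(1)] by simp
    show "pairing (u (1 * (2 * y))) n \<theta> = pairing v n \<theta> + 2 * shifted_margin X K n \<theta> z"
      "pairing (u ((- 1) * (2 * y))) n \<theta> = pairing v n \<theta> - 2 * shifted_margin X K n \<theta> z"
      if "\<theta> \<in> expansion_params X n r b" for n r b \<theta>
      using pair[OF that, of 1] pair[OF that, of "- 1"] by auto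
  qed (rule u)+
qed

lemma expected_uniform_deviation:
  assumes G: "countable G" "G \<noteq> {}" "G \<subseteq> expansion_params X n r b" and "0 \<le> r" "0 \<le> b"
  shows "(\<integral>S. (SUP \<theta>\<in>G. (\<Sum>i<n. (\<integral>z. ramp (shifted_margin X K n \<theta> z) \<partial>D)
      - ramp (shifted_margin X K n \<theta> (S i)))) \<partial>Pi\<^sub>M {..<n} (\<lambda>_. D))
    \<le> 2 * (\<tau> * r + 2 * b) * sqrt (\<tau>\<^sup>2 + 1) * sqrt n"
proof -
  define M where "M = \<tau> * r + 2 * b"
  have M: "0 \<le> M" using assms \<tau> by (simp add: M_def)
  \<comment> \<open>\<open>M\<close> bounds the norm of every triple in the class, so at m = 0 the
    bound is Cauchy-Schwarz; each sample point then adds 4 (tau^2 + 1) under the root, the average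
    increment of the squared norm.\<close>
  define \<Psi> where "\<Psi> m v = M * sqrt (sqnorm v + 4 * real m * (\<tau>\<^sup>2 + 1))" for m :: nat and v
  define V where "V = {v :: ('a \<Rightarrow> real) \<times> real \<times> real. fst v \<in> H}"
  have sq0: "0 \<le> sqnorm v" if "v \<in> V" for v
    using that ip_nonneg by (auto simp: V_def sqnorm_def case_prod_unfold)
  have inP: "\<theta> \<in> expansion_params X n r b" if "\<theta> \<in> G" for \<theta> using that G by blast
  \<comment> \<open>The zero functional starts the recursion: its pairing vanishes, leaving only the
    deviations.\<close>
  let ?v0 = "(\<lambda>_. 0, 0, 0) :: ('a \<Rightarrow> real) \<times> real \<times> real"
  have "(\<integral>S. (SUP \<theta>\<in>G. pairing ?v0 n \<theta> + (\<Sum>i<n. (\<integral>z. ramp (shifted_margin X K n \<theta> z) \<partial>D)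
      - ramp (shifted_margin X K n \<theta> (S i)))) \<partial>Pi\<^sub>M {..<n} (\<lambda>_. D)) \<le> \<Psi> n ?v0"
  proof (rule expected_uniform_deviation_le_potential[OF prob_D G(1,2),
        where l = "shifted_margin X K n" and B = "\<tau>\<^sup>2 * r + b + 2" and V = V])
    fix \<theta> z assume \<theta>: "\<theta> \<in> G"
    show "shifted_margin X K n \<theta> \<in> borel_measurable D"
      by (rule shifted_margin_measurable[OF inP[OF \<theta>]])
    then show "(\<lambda>z. ramp (shifted_margin X K n \<theta> z)) \<in> borel_measurable D" by simp
    assume z: "z \<in> space D"
    have "0 \<le> \<tau>\<^sup>2 * r + b" using assms by simp
    then show "\<bar>ramp (shifted_margin X K n \<theta> z)\<bar> \<le> \<tau>\<^sup>2 * r + b + 2"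
      using ramp_nonneg[of "shifted_margin X K n \<theta> z"] ramp_le_2[of "shifted_margin X K n \<theta> z"] by linarith
    show "\<bar>shifted_margin X K n \<theta> z\<bar> \<le> \<tau>\<^sup>2 * r + b + 2"
      using abs_shifted_margin_le[OF inP[OF \<theta>] z] by simp
  next
    fix v assume "v \<in> V"
    then show "\<exists>C. \<forall>g\<in>G. \<bar>pairing v n g\<bar> \<le> C"
      using abs_pairing_le[OF _ inP \<open>0 \<le> b\<close>, of v] unfolding V_def by blast
  next
    fix v \<theta> assume "v \<in> V" "\<theta> \<in> G"
    then show "pairing v n \<theta> \<le> \<Psi> 0 v"
      using abs_pairing_le[OF _ inP \<open>0 \<le> b\<close>, of v \<theta>] by (auto simp: V_def \<Psi>_def M_def)
  next
    fix m v z assume v: "v \<in> V" and z: "z \<in> space D"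
    from v have vH: "fst v \<in> H" by (simp add: V_def)
    obtain v1 v2 where s: "fst v1 \<in> H" "fst v2 \<in> H"
      "\<And>n r b \<theta>. \<theta> \<in> expansion_params X n r b \<Longrightarrow> pairing v1 n \<theta> = pairing v n \<theta> + 2 * shifted_margin X K n \<theta> z"
      "\<And>n r b \<theta>. \<theta> \<in> expansion_params X n r b \<Longrightarrow> pairing v2 n \<theta> = pairing v n \<theta> - 2 * shifted_margin X K n \<theta> z"
      "sqnorm v1 + sqnorm v2 \<le> 2 * sqnorm v + 8 * (\<tau>\<^sup>2 + 1)"
      using sqnorm_step[OF vH z] by blast
    have "\<Psi> m v1 + \<Psi> m v2 = M * (sqrt (sqnorm v1 + 4 * real m * (\<tau>\<^sup>2 + 1)) + sqrt (sqnorm v2 + 4 * real m * (\<tau>\<^sup>2 + 1)))"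
      by (simp add: \<Psi>_def algebra_simps)
    \<comment> \<open>Concavity of the square root turns the averaged increment of the squared norms
      into the recursion for \<open>\<Psi>\<close>.\<close>
    also have "\<dots> \<le> M * (2 * sqrt (sqnorm v + 4 * real (Suc m) * (\<tau>\<^sup>2 + 1)))"
      using s(1,2,5) sq0[of v1] sq0[of v2]
      by (intro mult_left_mono[OF _ M] sqrt_add_sqrt_le) (auto simp: V_def algebra_simps)
    finally have "\<Psi> m v1 + \<Psi> m v2 \<le> 2 * \<Psi> (Suc m) v" by (simp add: \<Psi>_def)
    moreover have "v1 \<in> V" "v2 \<in> V" using s(1,2) by (simp_all add: V_def)
    ultimately show "\<exists>v1\<in>V. \<exists>v2\<in>V.
      (\<forall>g\<in>G. pairing v1 n g = pairing v n g + 2 * shifted_margin X K n g z) \<and>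
      (\<forall>g\<in>G. pairing v2 n g = pairing v n g - 2 * shifted_margin X K n g z) \<and>
      \<Psi> m v1 + \<Psi> m v2 \<le> 2 * \<Psi> (Suc m) v"
      using s(3)[OF inP] s(4)[OF inP] by blast
  qed (auto simp: ramp_lipschitz V_def zero_mem)
  moreover have "pairing ?v0 n \<theta> = 0" if "\<theta> \<in> G" for \<theta>
    using ip_zero[OF expansion_in_H[OF inP[OF that]]] by (simp add: pairing_def)
  moreover have "\<Psi> n ?v0 = 2 * (\<tau> * r + 2 * b) * sqrt (\<tau>\<^sup>2 + 1) * sqrt n"
    using ip_zero[OF zero_mem] by (simp add: \<Psi>_def sqnorm_def M_def real_sqrt_mult)
  ultimately show ?thesis by (simp cong: SUP_cong)
qed

end

section \<open>Uniform deviation of the double ramp risk\<close>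

lemma sum_fun_upd_diff:
  fixes g :: "'z \<Rightarrow> real" and n :: nat
  assumes "i < n"
  shows "(\<Sum>j<n. g (S j)) - (\<Sum>j<n. g ((S(i := z)) j)) = g (S i) - g z"
proof -
  have "(\<Sum>j<n. g (S j)) - (\<Sum>j<n. g ((S(i := z)) j)) = (\<Sum>j<n. if j = i then g (S i) - g z else 0)"
    unfolding sum_subtractf[symmetric] by (intro sum.cong) auto
  also have "\<dots> = g (S i) - g z" using assms by simp
  finally show ?thesis .
qed

lemma integral_PiM_component:
  fixes f :: "'z \<Rightarrow> real"
  assumes "prob_space M" "i < n" "f \<in> borel_measurable M"
  shows "(\<integral>S. f (S i) \<partial>Pi\<^sub>M {..<n} (\<lambda>_. M)) = (\<integral>z. f z \<partial>M)"
proof -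
  have "distr (Pi\<^sub>M {..<n} (\<lambda>_. M)) M (\<lambda>\<omega>. \<omega> i) = M"
    using assms by (intro distr_PiM_component[of _ "\<lambda>_. M"]) auto
  then have "(\<integral>z. f z \<partial>M) = (\<integral>z. f z \<partial>distr (Pi\<^sub>M {..<n} (\<lambda>_. M)) M (\<lambda>\<omega>. \<omega> i))"
    by simp
  also have "\<dots> = (\<integral>S. f (S i) \<partial>Pi\<^sub>M {..<n} (\<lambda>_. M))"
    using assms by (intro integral_distr) auto
  finally show ?thesis ..
qed

lemma tendsto_fun_component:
  fixes u :: "nat \<Rightarrow> 'b \<Rightarrow> 'c::topological_space"
  assumes "u \<longlonglongrightarrow> l"
  shows "(\<lambda>k. u k i) \<longlonglongrightarrow> l i"
  by (rule continuous_on_tendsto_compose[OF continuous_on_product_coordinates assms]) auto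

text \<open>A ramp is constant on either side of [-1, 1]; once the offset exceeds
  \<open>B + 1\<close> in modulus, the bounded part \<open>u\<close> cannot bring the argument back
  inside.\<close>

lemma ramp_clip:
  assumes "\<bar>u\<bar> \<le> B"
  shows "ramp (u + max (- (B + 1)) (min (B + 1) p)) = ramp (u + p)"
  using assms by (auto simp: ramp_def pos_part_def min_def max_def)

context bounded_kernel_sample
begin

lemma shifted_margin_tendsto:
  assumes \<theta>: "\<And>k. \<theta> k \<in> expansion_params X n r b" "\<theta>' \<in> expansion_params X n r b" "\<theta> \<longlonglongrightarrow> \<theta>'"
    and z: "z \<in> space D"
  shows "(\<lambda>k. shifted_margin X K n (\<theta> k) z) \<longlonglongrightarrow> shifted_margin X K n \<theta>' z"
proof -
  have zX: "fst z \<in> X" using z unfolding space_D by auto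
  have x: "fst (snd (\<theta> k)) i \<in> X" "fst (snd \<theta>') i \<in> X" for k i
    using \<theta>(1)[of k] \<theta>(2) by (auto simp: expansion_params_def)
  have lim: "(\<lambda>k. fst (\<theta> k) i) \<longlonglongrightarrow> fst \<theta>' i" "(\<lambda>k. fst (snd (\<theta> k)) i) \<longlonglongrightarrow> fst (snd \<theta>') i" for i
    using tendsto_fst[OF \<theta>(3)] tendsto_fst[OF tendsto_snd[OF \<theta>(3)]] by (auto intro: tendsto_fun_component)
  have cK: "continuous_on (X \<times> X) (\<lambda>(x, y). K x y)" using mercer by (simp add: mercer_kernel_def)
  have "(\<lambda>k. K (fst (snd (\<theta> k)) i) (fst z)) \<longlonglongrightarrow> K (fst (snd \<theta>') i) (fst z)" for i
    using continuous_on_tendsto_compose[OF cK tendsto_Pair[OF lim(2)[of i] tendsto_const[of "fst z"]]] x zX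
    by simp
  then have "(\<lambda>k. \<Sum>i<n. fst (\<theta> k) i * kernel_section X K (fst (snd (\<theta> k)) i) (fst z))
      \<longlonglongrightarrow> (\<Sum>i<n. fst \<theta>' i * kernel_section X K (fst (snd \<theta>') i) (fst z))"
    using zX by (auto simp: kernel_section_def intro!: tendsto_sum tendsto_mult lim(1))
  then have e: "(\<lambda>k. expansion X K n (\<theta> k) (fst z)) \<longlonglongrightarrow> expansion X K n \<theta>' (fst z)"
    by (simp add: expansion_def case_prod_unfold)
  have "(\<lambda>k. if snd z = 1 then fst (snd (snd (\<theta> k))) else snd (snd (snd (\<theta> k))))
     \<longlonglongrightarrow> (if snd z = 1 then fst (snd (snd \<theta>')) else snd (snd (snd \<theta>')))"
    using tendsto_snd[OF tendsto_snd[OF \<theta>(3)]] by (auto intro!: tendsto_fst tendsto_snd)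
  then show ?thesis
    unfolding shifted_margin_def by (intro tendsto_add tendsto_mult tendsto_const e)
qed

definition deviation :: "nat \<Rightarrow> 'a shifted_expansion \<Rightarrow> (nat \<Rightarrow> 'a \<times> real) \<Rightarrow> real" where
  "deviation n \<theta> S = (\<Sum>i<n. (\<integral>z. ramp (shifted_margin X K n \<theta> z) \<partial>D) - ramp (shifted_margin X K n \<theta> (S i)))"

text \<open>Continuity in the parameters lets the supremum over the class be read off a countable
  dense subset. The mean is handled by dominated convergence, since ramps are bounded by 2.\<close>

lemma deviation_tendsto:
  assumes \<theta>: "\<And>k. \<theta> k \<in> expansion_params X n r b" "\<theta>' \<in> expansion_params X n r b" "\<theta> \<longlonglongrightarrow> \<theta>'"
    and S: "S \<in> space (Pi\<^sub>M {..<n} (\<lambda>_. D))"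
  shows "(\<lambda>k. deviation n (\<theta> k) S) \<longlonglongrightarrow> deviation n \<theta>' S"
proof -
  have ramp: "(\<lambda>k. ramp (shifted_margin X K n (\<theta> k) z)) \<longlonglongrightarrow> ramp (shifted_margin X K n \<theta>' z)"
    if "z \<in> space D" for z
    by (rule continuous_on_tendsto_compose[OF continuous_on_ramp shifted_margin_tendsto[OF \<theta> that]]) auto
  interpret prob_space D by (rule prob_D)
  have "(\<lambda>k. \<integral>z. ramp (shifted_margin X K n (\<theta> k) z) \<partial>D) \<longlonglongrightarrow> (\<integral>z. ramp (shifted_margin X K n \<theta>' z) \<partial>D)"
  proof (rule integral_dominated_convergence[where w = "\<lambda>_. 2"])
    show "AE z in D. (\<lambda>k. ramp (shifted_margin X K n (\<theta> k) z)) \<longlonglongrightarrow> ramp (shifted_margin X K n \<theta>' z)"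
      using ramp by (rule AE_I2)
    show "AE z in D. norm (ramp (shifted_margin X K n (\<theta> k) z)) \<le> 2" for k
      by (intro AE_I2) (simp add: ramp_nonneg ramp_le_2)
  qed (use shifted_margin_measurable[OF \<theta>(1)] shifted_margin_measurable[OF \<theta>(2)] in
      \<open>auto intro: measurable_compose[OF _ borel_measurable_ramp]\<close>)
  moreover have "S i \<in> space D" if "i < n" for i
    using S that by (auto simp: space_PiM)
  ultimately show ?thesis
    unfolding deviation_def by (intro tendsto_sum tendsto_diff ramp) auto
qed

lemma abs_mean_ramp_diff_le:
  assumes "\<theta> \<in> expansion_params X n r b"
  shows "\<bar>(\<integral>z. ramp (shifted_margin X K n \<theta> z) \<partial>D) - ramp u\<bar> \<le> 2"
proof -
  interpret prob_space D by (rule prob_D)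
  have int: "integrable D (\<lambda>z. ramp (shifted_margin X K n \<theta> z))"
    using shifted_margin_measurable[OF assms]
    by (intro integrable_bounded_prob[OF prob_D, where B = 2])
       (auto simp: ramp_nonneg ramp_le_2 intro: measurable_compose[OF _ borel_measurable_ramp])
  have "0 \<le> (\<integral>z. ramp (shifted_margin X K n \<theta> z) \<partial>D)"
    by (intro integral_nonneg_AE AE_I2 ramp_nonneg)
  moreover have "(\<integral>z. ramp (shifted_margin X K n \<theta> z) \<partial>D) \<le> 2"
    using integral_mono[OF int integrable_const[of 2] ramp_le_2] by (simp add: prob_space)
  ultimately show ?thesis using ramp_nonneg[of u] ramp_le_2[of u] by linarith
qed

lemma abs_deviation_le:
  assumes "\<theta> \<in> expansion_params X n r b"
  shows "\<bar>deviation n \<theta> S\<bar> \<le> 2 * real n"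
proof -
  have "\<bar>deviation n \<theta> S\<bar> \<le> (\<Sum>i<n. \<bar>(\<integral>z. ramp (shifted_margin X K n \<theta> z) \<partial>D) - ramp (shifted_margin X K n \<theta> (S i))\<bar>)"
    unfolding deviation_def by (rule sum_abs)
  also have "\<dots> \<le> (\<Sum>i<n. 2)" by (intro sum_mono abs_mean_ramp_diff_le[OF assms])
  finally show ?thesis by simp
qed

lemma deviation_fun_upd:
  assumes "i < n"
  shows "deviation n \<theta> S \<le> deviation n \<theta> (S(i := z)) + 2"
proof -
  let ?g = "\<lambda>w. (\<integral>z. ramp (shifted_margin X K n \<theta> z) \<partial>D) - ramp (shifted_margin X K n \<theta> w)"
  have "deviation n \<theta> S - deviation n \<theta> (S(i := z)) = ?g (S i) - ?g z"
    unfolding deviation_def by (rule sum_fun_upd_diff[OF assms, of ?g])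
  then show ?thesis
    using ramp_nonneg[of "shifted_margin X K n \<theta> (S i)"] ramp_le_2[of "shifted_margin X K n \<theta> z"] by linarith
qed

lemma deviation_measurable:
  assumes "\<theta> \<in> expansion_params X n r b"
  shows "deviation n \<theta> \<in> borel_measurable (Pi\<^sub>M {..<n} (\<lambda>_. D))"
proof -
  note [measurable] = shifted_margin_measurable[OF assms]
  show ?thesis unfolding deviation_def[abs_def] by measurable
qed

text \<open>\<open>f0\<close> stands for the loss of a function chosen before the sample. Its
  centred sum has mean zero, so adding it to the supremum leaves the expectation unchanged, and both
  fluctuations are controlled by one application of McDiarmid's inequality.\<close>

lemma uniform_deviation:
  assumes n: "0 < n" and "0 \<le> r" "0 \<le> b" and \<delta>: "0 < \<delta>" "\<delta> \<le> 1"
    and f0 [measurable]: "f0 \<in> borel_measurable D"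
    and f0b: "\<And>z. z \<in> space D \<Longrightarrow> 0 \<le> f0 z" "\<And>z. z \<in> space D \<Longrightarrow> f0 z \<le> 2"
  shows "\<exists>E\<in>sets (Pi\<^sub>M {..<n} (\<lambda>_. D)). 1 - \<delta> \<le> measure (Pi\<^sub>M {..<n} (\<lambda>_. D)) E \<and>
    (\<forall>S\<in>E. \<forall>\<theta>\<in>expansion_params X n r b.
      deviation n \<theta> S + (\<Sum>i<n. f0 (S i) - (\<integral>z. f0 z \<partial>D))
      \<le> 2 * (\<tau> * r + 2 * b) * sqrt (\<tau>\<^sup>2 + 1) * sqrt n + sqrt (8 * ln (4 / \<delta>)) * sqrt n)"
proof -
  let ?P = "Pi\<^sub>M {..<n} (\<lambda>_. D)"
  let ?\<Theta> = "expansion_params X n r b"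
  interpret D: prob_space D by (rule prob_D)
  interpret P: prob_space ?P by (rule prob_space_PiM[OF prob_D])
  obtain T where T: "countable T" "T \<subseteq> ?\<Theta>" "?\<Theta> \<subseteq> closure T"
    by (rule separable)
  obtain x0 where x0: "x0 \<in> X" using D.not_empty unfolding space_D by auto
  have "(\<lambda>_. 0, \<lambda>_. x0, 0, 0) \<in> ?\<Theta>"
    using x0 \<open>0 \<le> r\<close> \<open>0 \<le> b\<close> by (simp add: expansion_params_def)
  with T(3) have T0: "T \<noteq> {}" by auto
  note inT = subsetD[OF T(2)]
  define L where "L S = (SUP \<theta>\<in>T. deviation n \<theta> S)" for S
  have devT: "\<bar>deviation n \<theta> S\<bar> \<le> 2 * real n" if "\<theta> \<in> T" for \<theta> S
    by (rule abs_deviation_le[OF inT[OF that]])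
  have L_upper: "deviation n \<theta> S \<le> L S" if "\<theta> \<in> T" for \<theta> S
    unfolding L_def by (rule cSUP_upper[OF that bdd_above_abs[OF devT]])
  \<comment> \<open>A limit of parameters in \<open>T\<close> keeps the bound, so the countable
    supremum dominates the whole class.\<close>
  have L_upper': "deviation n \<theta> S \<le> L S" if S: "S \<in> space ?P" and \<theta>: "\<theta> \<in> ?\<Theta>" for \<theta> S
  proof -
    from \<theta> T(3) have "\<theta> \<in> closure T" by blast
    then obtain \<theta>s where \<theta>s: "\<And>k. \<theta>s k \<in> T" "\<theta>s \<longlonglongrightarrow> \<theta>"
      unfolding closure_sequential by blast
    show ?thesis
      using L_upper[OF \<theta>s(1)]
      by (intro LIMSEQ_le_const2[OF deviation_tendsto[OF inT[OF \<theta>s(1)] \<theta> \<theta>s(2) S]]) auto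
  qed
  have Lm [measurable]: "L \<in> borel_measurable ?P"
    unfolding L_def[abs_def] using T(1)
    by (auto intro!: borel_measurable_cSUP deviation_measurable[OF inT] bdd_above_abs[OF devT])
  have Lb: "\<bar>L S\<bar> \<le> 2 * real n" for S
    unfolding L_def by (rule abs_cSUP_le[OF T0 devT])
  have Ld: "L S \<le> L (S(i := z)) + 2" if "i < n" for S i z
    unfolding L_def[of S]
    by (rule cSUP_least[OF T0], rule order_trans[OF deviation_fun_upd[OF that] add_right_mono[OF L_upper]])
  define m where "m = (\<integral>z. f0 z \<partial>D)"
  have intf0: "integrable D f0"
    using f0b by (intro integrable_bounded_prob[OF prob_D, where B = 2]) auto
  have m: "\<bar>f0 z - m\<bar> \<le> 2" if "z \<in> space D" for z
  proof -
    have "0 \<le> m" unfolding m_def using f0b by (intro integral_nonneg_AE AE_I2)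
    moreover have "m \<le> 2"
      using integral_mono[OF intf0 D.integrable_const[of 2]] f0b by (simp add: D.prob_space m_def)
    ultimately show ?thesis using f0b[OF that] by linarith
  qed
  have sp: "S i \<in> space D" if "S \<in> space ?P" "i < n" for S i
    using that by (auto simp: space_PiM)
  define F where "F S = L S + (\<Sum>i<n. f0 (S i) - m)" for S
  have Fm: "F \<in> borel_measurable ?P" unfolding F_def[abs_def] by measurable
  have Sb: "\<bar>\<Sum>i<n. f0 (S i) - m\<bar> \<le> 2 * real n" if "S \<in> space ?P" for S
  proof -
    have "\<bar>\<Sum>i<n. f0 (S i) - m\<bar> \<le> (\<Sum>i<n. \<bar>f0 (S i) - m\<bar>)" by (rule sum_abs)
    also have "\<dots> \<le> (\<Sum>i<n. 2)" using sp[OF that] by (intro sum_mono m) auto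
    finally show ?thesis by simp
  qed
  have Fb: "\<bar>F S\<bar> \<le> 4 * real n" if "S \<in> space ?P" for S
    using Lb[of S] Sb[OF that] unfolding F_def by linarith
  \<comment> \<open>Replacing one example changes the supremum by at most 2 and the
    \<open>f0\<close> sum by at most 2.\<close>
  have Fd: "F S - F (S(i := z)) \<le> 4" if "S \<in> space ?P" "i < n" "z \<in> space D" for S i z
  proof -
    have "(\<Sum>j<n. f0 (S j) - m) - (\<Sum>j<n. f0 ((S(i := z)) j) - m) = (f0 (S i) - m) - (f0 z - m)"
      by (rule sum_fun_upd_diff[OF that(2), of "\<lambda>w. f0 w - m"])
    then show ?thesis
      using Ld[OF that(2), of S z] f0b(2)[OF sp[OF that(1,2)]] f0b(1)[OF that(3)] unfolding F_def by linarith
  qed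
  have EF: "(\<integral>S. F S \<partial>?P) \<le> 2 * (\<tau> * r + 2 * b) * sqrt (\<tau>\<^sup>2 + 1) * sqrt n"
  proof -
    have intc: "integrable ?P (\<lambda>S. f0 (S i) - m)" if "i < n" for i
      using that m sp by (intro integrable_bounded_prob[OF prob_space_PiM[OF prob_D], where B = 2]) auto
    have zero: "(\<integral>S. f0 (S i) - m \<partial>?P) = 0" if "i < n" for i
    proof -
      have "(\<integral>S. f0 (S i) - m \<partial>?P) = (\<integral>z. f0 z - m \<partial>D)"
        by (rule integral_PiM_component[OF prob_D that, of "\<lambda>z. f0 z - m"]) measurable
      then show ?thesis using intf0 by (simp add: m_def D.prob_space)
    qed
    have intL: "integrable ?P L"
      by (rule integrable_bounded_prob[OF prob_space_PiM[OF prob_D] Lm Lb])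
    have "(\<integral>S. F S \<partial>?P) = (\<integral>S. L S \<partial>?P) + (\<Sum>i<n. \<integral>S. f0 (S i) - m \<partial>?P)"
      unfolding F_def using intc intL by (subst Bochner_Integration.integral_add) (auto simp: integrable_sum)
    also have "\<dots> = (\<integral>S. L S \<partial>?P)" using zero by simp
    also have "\<dots> \<le> 2 * (\<tau> * r + 2 * b) * sqrt (\<tau>\<^sup>2 + 1) * sqrt n"
      unfolding L_def deviation_def
      by (rule expected_uniform_deviation[OF T(1) T0 T(2) \<open>0 \<le> r\<close> \<open>0 \<le> b\<close>])
    finally show ?thesis .
  qed
  define l where "l = ln (4 / \<delta>)"
  have l: "0 < l" using \<delta> by (simp add: l_def)
  \<comment> \<open>Chosen so that 2 t^2 / (n 4^2) = l; the exceptional event then has probability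
    at most \<delta> / 4.\<close>
  define t where "t = sqrt (8 * l) * sqrt n"
  have t: "0 < t" "t\<^sup>2 = 8 * l * real n" using l n by (auto simp: t_def power_mult_distrib)
  let ?B = "{S \<in> space ?P. (\<integral>S. F S \<partial>?P) + t \<le> F S}"
  have Bm: "?B \<in> sets ?P" using Fm by measurable
  have "measure ?P ?B \<le> exp (- 2 * t\<^sup>2 / (real n * 4\<^sup>2))"
    by (rule mcdiarmid[OF prob_D Fm Fb Fd n _ t(1)]) auto
  also have "- 2 * t\<^sup>2 / (real n * 4\<^sup>2) = - l" using n by (simp add: t(2))
  also have "exp (- l) = \<delta> / 4" using \<delta> by (simp add: l_def exp_minus field_simps)
  finally have "measure ?P ?B \<le> \<delta>" using \<delta> by simp
  then have "1 - \<delta> \<le> measure ?P (space ?P - ?B)" using P.prob_compl[OF Bm] by simp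
  moreover have "space ?P - ?B \<in> sets ?P" using Bm by auto
  moreover have "deviation n \<theta> S + (\<Sum>i<n. f0 (S i) - m)
      \<le> 2 * (\<tau> * r + 2 * b) * sqrt (\<tau>\<^sup>2 + 1) * sqrt n + sqrt (8 * l) * sqrt n"
    if "S \<in> space ?P - ?B" "\<theta> \<in> ?\<Theta>" for S \<theta>
  proof -
    have S: "S \<in> space ?P" and lt: "F S < (\<integral>S. F S \<partial>?P) + t" using that(1) by auto
    show ?thesis using L_upper'[OF S that(2)] lt EF unfolding F_def t_def by linarith
  qed
  ultimately show ?thesis unfolding m_def l_def by blast
qed

lemma loss_dr_shifted_margin:
  assumes "z \<in> space D"
  shows "loss_dr d (snd z * (expansion X K n (c, x, p, q) (fst z) + b)) \<rho>
    = d * ramp (shifted_margin X K n (c, x, b - \<rho>, - b - \<rho>) z)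
      + (1 - d) * ramp (shifted_margin X K n (c, x, b + \<rho>, - b + \<rho>) z)"
proof -
  have z: "snd z = 1 \<or> snd z = - 1" using assms unfolding space_D by auto
  have "snd z * (expansion X K n (c, x, p, q) (fst z) + b) - \<rho> = shifted_margin X K n (c, x, b - \<rho>, - b - \<rho>) z"
    "snd z * (expansion X K n (c, x, p, q) (fst z) + b) + \<rho> = shifted_margin X K n (c, x, b + \<rho>, - b + \<rho>) z"
    using z by (auto simp: shifted_margin_def expansion_def)
  then show ?thesis by (simp add: loss_dr_ramp)
qed

text \<open>On \<open>X\<close> the expansion is bounded by tau^2 r, so offsets past tau^2 r + 1
  saturate the ramp. This removes \<open>b\<close> and \<rho> from the size of the class.\<close>

lemma ramp_shifted_margin_clip:
  assumes "\<And>i. x i \<in> X" "(\<Sum>i<n. \<bar>c i\<bar>) \<le> r"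
  shows "\<exists>\<theta>\<in>expansion_params X n r (\<tau>\<^sup>2 * r + 1). \<forall>z\<in>space D.
    ramp (shifted_margin X K n (c, x, p, q) z) = ramp (shifted_margin X K n \<theta> z)"
proof -
  let ?B = "\<tau>\<^sup>2 * r"
  let ?clip = "\<lambda>p. max (- (?B + 1)) (min (?B + 1) p)"
  have "0 \<le> r" using order_trans[OF sum_nonneg assms(2)] by simp
  then have B: "0 \<le> ?B" by simp
  show ?thesis
  proof (intro bexI ballI)
    fix z assume z: "z \<in> space D"
    then have zz: "fst z \<in> X" "snd z = 1 \<or> snd z = - 1" unfolding space_D by auto
    \<comment> \<open>The bound on the expansion is taken with zero offsets, because the original
      offsets are arbitrary.\<close>
    have "(c, x, 0, 0) \<in> expansion_params X n r 0"
      using assms by (auto simp: expansion_params_def)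
    from abs_expansion_le[OF this zz(1)]
    have "\<bar>snd z * expansion X K n (c, x, p, q) (fst z)\<bar> \<le> ?B" for p q
      using zz(2) by (auto simp: expansion_def)
    from ramp_clip[OF this, of p q p] ramp_clip[OF this, of p q q]
    show "ramp (shifted_margin X K n (c, x, p, q) z) = ramp (shifted_margin X K n (c, x, ?clip p, ?clip q) z)"
      by (cases "snd z = 1") (simp_all add: shifted_margin_def expansion_def)
  next
    show "(c, x, max (- (\<tau>\<^sup>2 * r + 1)) (min (\<tau>\<^sup>2 * r + 1) p), max (- (\<tau>\<^sup>2 * r + 1)) (min (\<tau>\<^sup>2 * r + 1) q))
      \<in> expansion_params X n r (\<tau>\<^sup>2 * r + 1)"
      using assms B by (auto simp: expansion_params_def)
  qed
qed

text \<open>After clipping, the loss is a combination with weights \<open>d\<close> and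
  \<open>1 - d\<close> of ramps of two members of the class. The weights sum to 1, so the
  \<open>h0\<close> term can be attached in full to each of the two deviations.\<close>

lemma risk_dr_deviation:
  assumes d: "0 \<le> d" "d \<le> 1" and n: "0 < n" and "0 \<le> r" and \<delta>: "0 < \<delta>" "\<delta> \<le> 1" and h0: "h0 \<in> H"
  shows "\<exists>E\<in>sets (Pi\<^sub>M {..<n} (\<lambda>_. D)). 1 - \<delta> \<le> measure (Pi\<^sub>M {..<n} (\<lambda>_. D)) E \<and>
    (\<forall>S\<in>E. \<forall>c x b \<rho>. (\<forall>i. x i \<in> X) \<longrightarrow> (\<Sum>i<n. \<bar>c i\<bar>) \<le> r \<longrightarrow>
      (let f = (\<lambda>t. (\<Sum>i<n. c i * kernel_section X K (x i) t) + b); f0 = (\<lambda>t. h0 t + b0) in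
       (risk_dr D d f \<rho> - emp_risk_dr n S d f \<rho>) + (emp_risk_dr n S d f0 \<rho>0 - risk_dr D d f0 \<rho>0)
      \<le> (2 * (\<tau> * r + 2 * (\<tau>\<^sup>2 * r + 1)) * sqrt (\<tau>\<^sup>2 + 1) + sqrt (8 * ln (4 / \<delta>))) / sqrt n))"
proof -
  let ?P = "Pi\<^sub>M {..<n} (\<lambda>_. D)"
  let ?b = "\<tau>\<^sup>2 * r + 1"
  define f0 where "f0 z = loss_dr d (snd z * (h0 (fst z) + b0)) \<rho>0" for z
  note [measurable] = mem_measurable[OF h0]
  have f0m: "f0 \<in> borel_measurable D"
    unfolding f0_def[abs_def] loss_dr_ramp by measurable
  define R where "R = 2 * (\<tau> * r + 2 * ?b) * sqrt (\<tau>\<^sup>2 + 1) + sqrt (8 * ln (4 / \<delta>))"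
  have b: "0 \<le> ?b" using \<open>0 \<le> r\<close> by simp
  obtain E where E: "E \<in> sets ?P" "1 - \<delta> \<le> measure ?P E"
    and dev: "\<And>S \<theta>. S \<in> E \<Longrightarrow> \<theta> \<in> expansion_params X n r ?b \<Longrightarrow>
      deviation n \<theta> S + (\<Sum>i<n. f0 (S i) - (\<integral>z. f0 z \<partial>D)) \<le> R * sqrt n"
    using uniform_deviation[OF n \<open>0 \<le> r\<close> b \<delta> f0m] loss_dr_bounds[OF d]
    unfolding f0_def R_def distrib_right by blast
  have "(risk_dr D d f \<rho> - emp_risk_dr n S d f \<rho>)
      + (emp_risk_dr n S d (\<lambda>t. h0 t + b0) \<rho>0 - risk_dr D d (\<lambda>t. h0 t + b0) \<rho>0) \<le> R / sqrt n"
    if S: "S \<in> E" and x: "\<And>i. x i \<in> X" and c: "(\<Sum>i<n. \<bar>c i\<bar>) \<le> r"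
      and f: "f = (\<lambda>t. (\<Sum>i<n. c i * kernel_section X K (x i) t) + b)" for S c x b \<rho> f
  proof -
    have Sp: "S i \<in> space D" if "i < n" for i
      using sets.sets_into_space[OF E(1)] S that by (auto simp: space_PiM)
    obtain \<theta>1 where \<theta>1: "\<theta>1 \<in> expansion_params X n r ?b"
      "\<And>z. z \<in> space D \<Longrightarrow> ramp (shifted_margin X K n (c, x, b - \<rho>, - b - \<rho>) z) = ramp (shifted_margin X K n \<theta>1 z)"
      using ramp_shifted_margin_clip[where x = x, OF x c, where p = "b - \<rho>" and q = "- b - \<rho>"] by blast
    obtain \<theta>2 where \<theta>2: "\<theta>2 \<in> expansion_params X n r ?b"
      "\<And>z. z \<in> space D \<Longrightarrow> ramp (shifted_margin X K n (c, x, b + \<rho>, - b + \<rho>) z) = ramp (shifted_margin X K n \<theta>2 z)"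
      using ramp_shifted_margin_clip[where x = x, OF x c, where p = "b + \<rho>" and q = "- b + \<rho>"] by blast
    have loss: "loss_dr d (snd z * f (fst z)) \<rho> = d * ramp (shifted_margin X K n \<theta>1 z) + (1 - d) * ramp (shifted_margin X K n \<theta>2 z)"
      if "z \<in> space D" for z
      using loss_dr_shifted_margin[OF that, of d n c x 0 0 b \<rho>] \<theta>1(2)[OF that] \<theta>2(2)[OF that]
      by (simp add: f expansion_def)
    have int: "integrable D (\<lambda>z. ramp (shifted_margin X K n \<theta> z))" if "\<theta> \<in> expansion_params X n r ?b" for \<theta>
      using shifted_margin_measurable[OF that]
      by (intro integrable_bounded_prob[OF prob_D, where B = 2])
         (auto simp: ramp_nonneg ramp_le_2 intro: measurable_compose[OF _ borel_measurable_ramp])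
    have risk: "risk_dr D d f \<rho> = d * (\<integral>z. ramp (shifted_margin X K n \<theta>1 z) \<partial>D) + (1 - d) * (\<integral>z. ramp (shifted_margin X K n \<theta>2 z) \<partial>D)"
      unfolding risk_dr_def using int[OF \<theta>1(1)] int[OF \<theta>2(1)]
      by (subst Bochner_Integration.integral_cong[OF refl loss]) auto
    have emp: "real n * emp_risk_dr n S d f \<rho> = d * (\<Sum>i<n. ramp (shifted_margin X K n \<theta>1 (S i)))
        + (1 - d) * (\<Sum>i<n. ramp (shifted_margin X K n \<theta>2 (S i)))"
      using n Sp by (simp add: emp_risk_dr_def loss sum.distrib sum_distrib_left)
    have "real n * (risk_dr D d f \<rho> - emp_risk_dr n S d f \<rho>) = d * deviation n \<theta>1 S + (1 - d) * deviation n \<theta>2 S"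
      unfolding right_diff_distrib emp risk deviation_def sum_subtractf by (simp add: algebra_simps)
    moreover have "real n * (emp_risk_dr n S d (\<lambda>t. h0 t + b0) \<rho>0 - risk_dr D d (\<lambda>t. h0 t + b0) \<rho>0)
        = (\<Sum>i<n. f0 (S i) - (\<integral>z. f0 z \<partial>D))" (is "_ = ?s")
      using n by (simp add: emp_risk_dr_def risk_dr_def f0_def sum_subtractf algebra_simps)
    ultimately have "real n * ((risk_dr D d f \<rho> - emp_risk_dr n S d f \<rho>)
        + (emp_risk_dr n S d (\<lambda>t. h0 t + b0) \<rho>0 - risk_dr D d (\<lambda>t. h0 t + b0) \<rho>0))
      = d * (deviation n \<theta>1 S + ?s) + (1 - d) * (deviation n \<theta>2 S + ?s)"
      by (simp add: algebra_simps)
    also have "\<dots> \<le> d * (R * sqrt n) + (1 - d) * (R * sqrt n)"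
      using d dev[OF S \<theta>1(1)] dev[OF S \<theta>2(1)] by (intro add_mono mult_left_mono) auto
    also have "\<dots> = R * (real n / sqrt n)"
      by (simp add: real_div_sqrt algebra_simps)
    also have "\<dots> = real n * (R / sqrt n)" by simp
    finally show ?thesis using n by (simp only: mult_le_cancel_left_pos of_nat_0_less_iff)
  qed
  then show ?thesis
    unfolding Let_def R_def[symmetric] using E by blast
qed

end

section \<open>Comparison with the regularized approximation and with the Bayes risks\<close>

context rkhs
begin

lemma dual_maximizer_exists:
  fixes x :: "nat \<Rightarrow> 'a" and y t :: "nat \<Rightarrow> real"
  assumes x: "\<And>i. i < n \<Longrightarrow> x i \<in> X" and "0 \<le> C"
    and g_def: "g = (\<lambda>\<alpha> s. \<Sum>i<n. (y i * \<alpha> i) * kernel_section X K (x i) s)"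
    and Q_def: "Q = (\<lambda>\<alpha>. (\<Sum>i<n. \<alpha> i * t i) - ip (g \<alpha>) (g \<alpha>) / 2)"
  shows "\<exists>\<alpha>. (\<forall>i<n. 0 \<le> \<alpha> i \<and> \<alpha> i \<le> C) \<and>
    (\<forall>\<alpha>'. (\<forall>i<n. 0 \<le> \<alpha>' i \<and> \<alpha>' i \<le> C) \<longrightarrow> Q \<alpha>' \<le> Q \<alpha>)"
proof -
  \<comment> \<open>Coordinates from \<open>n\<close> on are fixed at 0, so that the box is a
    product of compact sets and Tychonoff's theorem applies.\<close>
  define B where "B = (\<Pi>\<^sub>E i\<in>UNIV. if i < n then {0..C} else {0::real})"
  have B: "\<alpha> \<in> B \<longleftrightarrow> (\<forall>i. (i < n \<longrightarrow> 0 \<le> \<alpha> i \<and> \<alpha> i \<le> C) \<and> (\<not> i < n \<longrightarrow> \<alpha> i = 0))" for \<alpha>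
    by (auto simp: B_def PiE_iff split: if_splits)
  have "compactin (product_topology (\<lambda>_. euclidean) UNIV) B"
    unfolding B_def by (auto simp: compactin_PiE)
  then have comp: "compact B"
    by (simp add: euclidean_product_topology)
  have "(\<lambda>_. 0) \<in> B" using \<open>0 \<le> C\<close> by (simp add: B)
  then have ne: "B \<noteq> {}" by blast
  have gH: "g \<alpha> \<in> H" for \<alpha> unfolding g_def using x by (rule expansion_mem)
  \<comment> \<open>Evaluating \<open>g \<alpha>\<close> at its centres turns the quadratic form
    into a polynomial in the coordinates, whose continuity is immediate.\<close>
  have "ip (g \<alpha>) (g \<alpha>) = (\<Sum>i<n. (y i * \<alpha> i) * g \<alpha> (x i))" for \<alpha>
    using ip_expansion[of n x "g \<alpha>" "\<lambda>i. y i * \<alpha> i", OF x gH] by (simp add: g_def)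
  then have Q: "Q = (\<lambda>\<alpha>. (\<Sum>i<n. \<alpha> i * t i) - (\<Sum>i<n. (y i * \<alpha> i) * g \<alpha> (x i)) / 2)"
    by (simp add: Q_def)
  have coord: "continuous_on B (\<lambda>\<alpha>. \<alpha> i)" for i
    by (rule continuous_on_subset[OF continuous_on_product_coordinates]) simp
  have "continuous_on B Q"
    unfolding Q g_def by (intro continuous_intros coord) auto
  from continuous_attains_sup[OF comp ne this] obtain \<alpha> where \<alpha>: "\<alpha> \<in> B" "\<And>\<beta>. \<beta> \<in> B \<Longrightarrow> Q \<beta> \<le> Q \<alpha>"
    by blast
  show ?thesis
  proof (intro exI[of _ \<alpha>] conjI allI impI)
    fix \<alpha>' assume *: "\<forall>i<n. 0 \<le> \<alpha>' i \<and> \<alpha>' i \<le> C"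
    let ?\<beta> = "\<lambda>i. if i < n then \<alpha>' i else 0"
    have "Q \<alpha>' = Q ?\<beta>" by (simp add: Q_def g_def)
    also have "\<dots> \<le> Q \<alpha>" using * by (intro \<alpha>(2)) (simp add: B)
    finally show "Q \<alpha>' \<le> Q \<alpha>" .
  qed (use \<alpha>(1) in \<open>auto simp: B\<close>)
qed

text \<open>First-order optimality: dividing by the increment and letting it tend to 0 removes the
  quadratic term.\<close>

lemma quadratic_increment_nonpos:
  fixes G k :: real
  assumes "0 < e0" and le: "\<And>e. 0 < e \<Longrightarrow> e \<le> e0 \<Longrightarrow> e * G - e\<^sup>2 * k / 2 \<le> 0"
  shows "G \<le> 0"
proof -
  have "G \<le> 0 * k / 2"
  proof (rule tendsto_le[of "at_right (0::real)"])
    show "((\<lambda>e. e * k / 2) \<longlongrightarrow> 0 * k / 2) (at_right 0)" by (intro tendsto_intros) auto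
    show "((\<lambda>e. G) \<longlongrightarrow> G) (at_right (0::real))" by simp
    show "\<forall>\<^sub>F e in at_right 0. G \<le> e * k / 2"
      unfolding eventually_at_right_field
    proof (intro exI[of _ e0] conjI allI impI)
      fix e :: real assume e: "0 < e" "e < e0"
      with le[of e] have "e * (G - e * k / 2) \<le> e * 0" by (simp add: algebra_simps power2_eq_square)
      with e show "G \<le> e * k / 2" by (simp only: mult_le_cancel_left_pos)
    qed (use \<open>0 < e0\<close> in simp)
  qed auto
  then show ?thesis by simp
qed

text \<open>The box constraint is the dual of the hinge penalty
  \<open>C \<Sum>\<^sub>i max 0 (y\<^sub>i h0(x\<^sub>i) - y\<^sub>i g(x\<^sub>i))\<close>; complementary slackness at the dual maximizer
  evaluates this penalty exactly.\<close>

lemma box_expansion_dominating: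
  fixes x :: "nat \<Rightarrow> 'a" and y :: "nat \<Rightarrow> real"
  assumes x: "\<And>i. i < n \<Longrightarrow> x i \<in> X" and C: "0 \<le> C" and h0: "h0 \<in> H"
  shows "\<exists>\<alpha>. (\<forall>i<n. 0 \<le> \<alpha> i \<and> \<alpha> i \<le> C) \<and>
    (let g = (\<lambda>s. \<Sum>i<n. (y i * \<alpha> i) * kernel_section X K (x i) s) in
     C * (\<Sum>i<n. max 0 (y i * h0 (x i) - y i * g (x i))) \<le> ip h0 h0 / 2)"
proof -
  define g where "g = (\<lambda>\<alpha> s. \<Sum>i<n. (y i * \<alpha> i) * kernel_section X K (x i) s)"
  define Q where "Q = (\<lambda>\<alpha>. (\<Sum>i<n. \<alpha> i * (y i * h0 (x i))) - ip (g \<alpha>) (g \<alpha>) / 2)"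
  obtain \<alpha> where \<alpha>: "\<And>i. i < n \<Longrightarrow> 0 \<le> \<alpha> i" "\<And>i. i < n \<Longrightarrow> \<alpha> i \<le> C"
    and max: "\<And>\<beta>. (\<And>i. i < n \<Longrightarrow> 0 \<le> \<beta> i \<and> \<beta> i \<le> C) \<Longrightarrow> Q \<beta> \<le> Q \<alpha>"
    using dual_maximizer_exists[OF x C g_def Q_def] by blast
  have gH: "g \<beta> \<in> H" for \<beta> unfolding g_def using x by (rule expansion_mem)
  \<comment> \<open>\<open>G i\<close> is both the margin deficit at example \<open>i\<close> and
    the partial derivative of \<open>Q\<close> in coordinate \<open>i\<close> at the
    maximizer.\<close>
  define G where "G i = y i * h0 (x i) - y i * g \<alpha> (x i)" for i
  have inc: "Q (\<alpha>(i := \<alpha> i + e)) = Q \<alpha> + (e * G i - e\<^sup>2 * ((y i)\<^sup>2 * K (x i) (x i)) / 2)" if i: "i < n" for i e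
  proof -
    let ?k = "kernel_section X K (x i)"
    have upd: "(\<Sum>j<n. (\<alpha>(i := \<alpha> i + e)) j * f j) = (\<Sum>j<n. \<alpha> j * f j) + e * f i" for f :: "nat \<Rightarrow> real"
    proof -
      have "(\<Sum>j<n. (\<alpha>(i := \<alpha> i + e)) j * f j) = (\<Sum>j<n. \<alpha> j * f j + (if j = i then e * f i else 0))"
        by (intro sum.cong) (auto simp: algebra_simps)
      then show ?thesis using i by (simp add: sum.distrib)
    qed
    have "g (\<alpha>(i := \<alpha> i + e)) = (\<lambda>s. g \<alpha> s + (e * y i) * ?k s)"
    proof
      fix s
      show "g (\<alpha>(i := \<alpha> i + e)) s = g \<alpha> s + (e * y i) * ?k s"
        using upd[of "\<lambda>j. y j * kernel_section X K (x j) s"] by (simp add: g_def ac_simps)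
    qed
    then have "ip (g (\<alpha>(i := \<alpha> i + e))) (g (\<alpha>(i := \<alpha> i + e)))
        = ip (g \<alpha>) (g \<alpha>) + 2 * (e * y i) * g \<alpha> (x i) + (e * y i)\<^sup>2 * K (x i) (x i)"
      using ip_add_scale_self[OF gH section_mem[OF x[OF i]], of \<alpha> "e * y i"]
        reproducing[OF gH x[OF i]] section_ip_self[OF x[OF i]] by simp
    then show ?thesis
      unfolding Q_def upd G_def by (simp add: algebra_simps power2_eq_square diff_divide_distrib add_divide_distrib)
  qed
  have slack: "\<alpha> i * G i = C * max 0 (G i)" if i: "i < n" for i
  proof -
    \<comment> \<open>Below \<open>C\<close> the coordinate may increase, above 0 it may decrease;
      each freedom forces a sign of the derivative.\<close>
    have up: "G i \<le> 0" if "\<alpha> i < C"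
    proof (rule quadratic_increment_nonpos[of "C - \<alpha> i"])
      fix e assume e: "0 < e" "e \<le> C - \<alpha> i"
      have "Q (\<alpha>(i := \<alpha> i + e)) \<le> Q \<alpha>" using \<alpha> e i by (intro max) auto
      then show "e * G i - e\<^sup>2 * ((y i)\<^sup>2 * K (x i) (x i)) / 2 \<le> 0" unfolding inc[OF i] by simp
    qed (use that in simp)
    have down: "- G i \<le> 0" if "0 < \<alpha> i"
    proof (rule quadratic_increment_nonpos[of "\<alpha> i"])
      fix e assume e: "0 < e" "e \<le> \<alpha> i"
      have "\<alpha> i - e \<le> C" using \<alpha>(2)[OF i] e by simp
      then have "Q (\<alpha>(i := \<alpha> i + (- e))) \<le> Q \<alpha>" using \<alpha> e i by (intro max) auto
      then show "e * (- G i) - e\<^sup>2 * ((y i)\<^sup>2 * K (x i) (x i)) / 2 \<le> 0" unfolding inc[OF i] by simp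
    qed (use that in simp)
    consider "0 < G i" | "G i = 0" | "G i < 0" by linarith
    then show ?thesis
    proof cases
      case 1
      then have "\<alpha> i = C" using up \<alpha>(2)[OF i] by force
      then show ?thesis using 1 by simp
    next
      case 3
      then have "\<alpha> i = 0" using down \<alpha>(1)[OF i] by force
      then show ?thesis using 3 by simp
    qed simp
  qed
  have "C * (\<Sum>i<n. max 0 (G i)) = (\<Sum>i<n. \<alpha> i * G i)"
    using slack by (simp add: sum_distrib_left)
  also have "\<dots> = (\<Sum>i<n. (y i * \<alpha> i) * h0 (x i)) - (\<Sum>i<n. (y i * \<alpha> i) * g \<alpha> (x i))"
    by (simp add: G_def sum_subtractf algebra_simps)
  also have "\<dots> = ip (g \<alpha>) h0 - ip (g \<alpha>) (g \<alpha>)"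
    using ip_expansion[of n x h0 "\<lambda>i. y i * \<alpha> i", OF x h0] ip_expansion[of n x "g \<alpha>" "\<lambda>i. y i * \<alpha> i", OF x gH]
    by (simp add: g_def)
  \<comment> \<open>The mixed product is at most half of |g|^2 + |h0|^2, and subtracting |g|^2
    leaves at most half of |h0|^2.\<close>
  also have "\<dots> \<le> ip h0 h0 / 2"
    using ip_le_half_sum[OF gH h0, of \<alpha>] ip_nonneg[OF gH, of \<alpha>] by argo
  finally have "C * (\<Sum>i<n. max 0 (y i * h0 (x i) - y i * g \<alpha> (x i))) \<le> ip h0 h0 / 2"
    unfolding G_def .
  with \<alpha> show ?thesis unfolding g_def Let_def by blast
qed

end

section \<open>The regularizer and the SDR-SVM solution\<close>

lemma Omega_le:
  assumes "\<And>i. i < N \<Longrightarrow> 0 \<le> \<alpha> i"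
  shows "Omega X K N S (kernel_expansion X K N S \<alpha>) \<le> (\<Sum>i<N. \<alpha> i)"
  unfolding Omega_def
proof (rule cInf_lower)
  show "bdd_below {\<Sum>i<N. \<alpha>' i | \<alpha>'. (\<forall>i<N. 0 \<le> \<alpha>' i) \<and> kernel_expansion X K N S \<alpha> = kernel_expansion X K N S \<alpha>'}"
    by (auto intro!: bdd_belowI[of _ 0] sum_nonneg)
qed (use assms in blast)

lemma Omega_nonneg:
  assumes "h \<in> H_plus X K N S"
  shows "0 \<le> Omega X K N S h"
  unfolding Omega_def
proof (rule cInf_greatest)
  show "{\<Sum>i<N. \<alpha> i | \<alpha>. (\<forall>i<N. 0 \<le> \<alpha> i) \<and> h = kernel_expansion X K N S \<alpha>} \<noteq> {}"
    using assms by (auto simp: H_plus_def)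
qed (auto intro!: sum_nonneg)

lemma emp_risk_dr_nonneg: "0 \<le> d \<Longrightarrow> d \<le> 1 \<Longrightarrow> 0 \<le> emp_risk_dr N S d f \<rho>"
  unfolding emp_risk_dr_def by (intro divide_nonneg_nonneg sum_nonneg loss_dr_bounds) auto

text \<open>Comparison with the zero function at b = 0 and \<rho> = 1, where the loss is 2 d <= 1,
  bounds \<open>Omega\<close> by 1 / lam1. \<open>Omega\<close> is an infimum over representations;
  the doubled bound leaves room to pick one of them.\<close>

lemma sdr_svm_solution_expansion:
  assumes sol: "sdr_svm_solution X K d N S lam1 h b \<rho>" and "0 < lam1" and d: "0 \<le> d" "d \<le> 1 / 2"
  obtains \<alpha> where "\<And>i. i < N \<Longrightarrow> 0 \<le> \<alpha> i" "h = kernel_expansion X K N S \<alpha>" "(\<Sum>i<N. \<alpha> i) \<le> 2 / lam1"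
proof -
  let ?z = "kernel_expansion X K N S (\<lambda>_. 0)"
  have z: "?z \<in> H_plus X K N S" unfolding H_plus_def by (rule CollectI, rule exI[of _ "\<lambda>_. 0"]) simp
  have h: "h \<in> H_plus X K N S" using sol by (simp add: sdr_svm_solution_def)
  have "?z = (\<lambda>_. 0)" by (simp add: kernel_expansion_def)
  then have "emp_risk_dr N S d (\<lambda>x. ?z x + 0) 1 = (\<Sum>i<N. 2 * d) / real N"
    by (simp add: emp_risk_dr_def loss_dr_ramp ramp_eq)
  also have "\<dots> \<le> 1" using d by simp
  finally have e: "emp_risk_dr N S d (\<lambda>x. ?z x + 0) 1 \<le> 1" .
  have "sdr_objective X K d N S lam1 h b \<rho> \<le> sdr_objective X K d N S lam1 ?z 0 1"
    using sol z unfolding sdr_svm_solution_def by blast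
  moreover have "Omega X K N S ?z \<le> 0"
    using Omega_le[of N "\<lambda>_. 0" X K S] by simp
  then have "lam1 * Omega X K N S ?z \<le> 0"
    using \<open>0 < lam1\<close> by (simp add: mult_nonneg_nonpos)
  moreover have "0 \<le> emp_risk_dr N S d (\<lambda>x. h x + b) \<rho>" using d by (intro emp_risk_dr_nonneg) auto
  ultimately have "lam1 * Omega X K N S h \<le> 1" using e unfolding sdr_objective_def by linarith
  then have "Omega X K N S h \<le> 1 / lam1" using \<open>0 < lam1\<close> by (simp add: field_simps)
  also have "\<dots> < 2 / lam1" using \<open>0 < lam1\<close> by (simp add: divide_strict_right_mono)
  finally have lt: "Omega X K N S h < 2 / lam1" .
  have "{\<Sum>i<N. \<alpha> i | \<alpha>. (\<forall>i<N. 0 \<le> \<alpha> i) \<and> h = kernel_expansion X K N S \<alpha>} \<noteq> {}"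
    using h by (auto simp: H_plus_def)
  from cInf_lessD[OF this lt[unfolded Omega_def]] show ?thesis using that by force
qed

text \<open>The competitor keeps \<open>b0\<close> and \<open>\<rho>0\<close>, and replaces
  \<open>h0\<close>, which need not belong to the hypothesis space of the sample, by its dominating
  box expansion.\<close>

lemma sdr_svm_solution_emp_risk_le:
  assumes r: "rkhs X K H ip" and sol: "sdr_svm_solution X K d N S lam1 h b \<rho>"
    and N: "0 < N" and lam: "0 < lam1" "0 < lam2" and d: "0 \<le> d" "d \<le> 1"
    and S: "\<And>i. i < N \<Longrightarrow> fst (S i) \<in> X" "\<And>i. i < N \<Longrightarrow> snd (S i) = 1 \<or> snd (S i) = - 1"
    and h0: "h0 \<in> H" and "1 \<le> \<rho>0"
  shows "emp_risk_dr N S d (\<lambda>x. h x + b) \<rho>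
    \<le> lam1 / lam2 + lam2 / 2 * (ip_norm ip h0)\<^sup>2 + emp_risk_dr N S d (\<lambda>x. h0 x + b0) \<rho>0"
proof -
  interpret rkhs X K H ip by fact
  \<comment> \<open>With this box size the coefficients sum to at most N C = 1 / lam2, and the
    averaged hinge penalty is lam2 times the quantity bounded by half of |h0|^2.\<close>
  define C where "C = 1 / (lam2 * real N)"
  have C: "0 < C" using lam N by (simp add: C_def)
  obtain \<alpha> where \<alpha>: "\<And>i. i < N \<Longrightarrow> 0 \<le> \<alpha> i" "\<And>i. i < N \<Longrightarrow> \<alpha> i \<le> C"
    and dom: "C * (\<Sum>i<N. max 0 (snd (S i) * h0 (fst (S i)) - snd (S i) * kernel_expansion X K N S \<alpha> (fst (S i)))) \<le> ip h0 h0 / 2"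
    using box_expansion_dominating[of N "\<lambda>i. fst (S i)" C h0 "\<lambda>i. snd (S i)", OF S(1) less_imp_le[OF C] h0]
    unfolding kernel_expansion_def Let_def by blast
  let ?g = "kernel_expansion X K N S \<alpha>"
  let ?M = "\<Sum>i<N. max 0 (snd (S i) * h0 (fst (S i)) - snd (S i) * ?g (fst (S i)))"
  have g: "?g \<in> H_plus X K N S" using \<alpha> unfolding H_plus_def by blast
  have "Omega X K N S ?g \<le> (\<Sum>i<N. \<alpha> i)" by (rule Omega_le[OF \<alpha>(1)])
  also have "\<dots> \<le> (\<Sum>i<N. C)" using \<alpha>(2) by (intro sum_mono) auto
  also have "\<dots> = 1 / lam2" using N by (simp add: C_def)
  finally have "lam1 * Omega X K N S ?g \<le> lam1 / lam2"
    using lam mult_left_mono[of "Omega X K N S ?g" "1 / lam2" lam1] by simp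
  moreover have "?M / real N \<le> lam2 / 2 * (ip_norm ip h0)\<^sup>2"
  proof -
    have "?M / real N = lam2 * (C * ?M)" using N lam by (simp add: C_def)
    also have "\<dots> \<le> lam2 * (ip h0 h0 / 2)" using dom lam by (intro mult_left_mono) auto
    finally show ?thesis by (simp add: nrm_power2[OF h0])
  qed
  moreover have "emp_risk_dr N S d (\<lambda>x. ?g x + b0) \<rho>0 \<le> emp_risk_dr N S d (\<lambda>x. h0 x + b0) \<rho>0 + ?M / real N"
    unfolding emp_risk_dr_def add_divide_distrib[symmetric] sum.distrib[symmetric]
  proof (intro divide_right_mono sum_mono)
    fix i assume "i \<in> {..<N}"
    have "snd (S i) * (h0 (fst (S i)) + b0) - snd (S i) * (?g (fst (S i)) + b0)
        = snd (S i) * h0 (fst (S i)) - snd (S i) * ?g (fst (S i))"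
      by (simp add: algebra_simps)
    then show "loss_dr d (snd (S i) * (?g (fst (S i)) + b0)) \<rho>0
      \<le> loss_dr d (snd (S i) * (h0 (fst (S i)) + b0)) \<rho>0
        + max 0 (snd (S i) * h0 (fst (S i)) - snd (S i) * ?g (fst (S i)))"
      using loss_dr_le_add_pos_part[OF d, of "snd (S i) * (?g (fst (S i)) + b0)" \<rho>0 "snd (S i) * (h0 (fst (S i)) + b0)"]
      by simp
  qed simp
  moreover have "sdr_objective X K d N S lam1 h b \<rho> \<le> sdr_objective X K d N S lam1 ?g b0 \<rho>0"
    using sol g \<open>1 \<le> \<rho>0\<close> unfolding sdr_svm_solution_def by blast
  moreover have "0 \<le> lam1 * Omega X K N S h"
    using sol lam Omega_nonneg unfolding sdr_svm_solution_def by (metis mult_nonneg_nonneg less_imp_le)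
  ultimately show ?thesis unfolding sdr_objective_def by linarith
qed

section \<open>From double ramp risk to reject-option risk\<close>

lemma loss_d_indicator: "loss_d d t \<rho> = indicator {..<- \<rho>} t + d * indicator {- \<rho>..\<rho>} t"
  by (auto simp: loss_d_def indicator_def abs_le_iff)

lemma abs_loss_d_le: "\<bar>loss_d d t \<rho>\<bar> \<le> 1 + \<bar>d\<bar>"
  by (auto simp: loss_d_def)

text \<open>Conditioning on x reduces the claim to the pointwise bound
  \<open>cond_loss_dr_ge\<close>. The optimal risks are E m and 2 E m for m the minimum of eta, d
  and 1 - eta, so integrating that bound gives exactly the comparison of excess risks.\<close>

lemma excess_risk_d_le_excess_risk_dr:
  fixes X :: "'a::topological_space set"
  assumes dist: "labelled_distribution X D" and d: "0 < d" "d < 1 / 2"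
    and f: "f \<in> borel_measurable (restrict_space borel X)" and \<rho>: "1 \<le> \<rho>"
  shows "risk_d D d f \<rho> - bayes_risk_d D d \<le> risk_dr D d f \<rho> - bayes_risk_dr D d"
proof -
  note D = labelled_distributionD[OF dist]
  interpret prob_space D by (rule D(1))
  \<comment> \<open>The sigma-algebra in the definition of \<open>eta\<close>: events that depend on
    x alone.\<close>
  define F where "F = vimage_algebra (space D) fst (borel :: 'a measure)"
  have fst_borel: "fst \<in> D \<rightarrow>\<^sub>M borel"
    using measurable_compose[OF D(3) measurable_restrict_space1[OF measurable_ident]] by simp
  have sp: "space F = space D" by (simp add: F_def)
  have sub: "subalgebra D F"
    unfolding subalgebra_def sp F_def
    using measurable_sets[OF fst_borel] by (auto simp: sets_vimage_algebra2)
  interpret finite_measure_subalgebra D F by unfold_locales (rule sub)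
  have fstF: "fst \<in> F \<rightarrow>\<^sub>M restrict_space borel X"
  proof (rule measurable_restrict_space2)
    show "fst \<in> F \<rightarrow>\<^sub>M borel" unfolding F_def by (rule measurable_vimage_algebra1) simp
    show "fst \<in> space F \<rightarrow> X" unfolding sp D(2) by auto
  qed
  have fF: "(\<lambda>z. f (fst z)) \<in> borel_measurable F"
    by (rule measurable_compose[OF fstF f])
  define u :: "'a \<times> real \<Rightarrow> real" where "u = indicator {z. snd z = 1}"
  have um [measurable]: "u \<in> borel_measurable D"
  proof -
    have "u = (\<lambda>z. indicator {1} (snd z))" by (auto simp: u_def indicator_def)
    then show ?thesis using D(4) by simp
  qed
  have eta: "eta D = real_cond_exp D F u" by (simp add: eta_def F_def u_def)
  \<comment> \<open>For labels 1 and -1 the loss equals (l(f) - l(-f)) u + l(-f), where the factor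
    of \<open>u\<close> is measurable in x alone; so \<open>u\<close> may be replaced by its
    conditional expectation \<open>eta D\<close>. The statement for general \<open>l\<close> serves
    both losses.\<close>
  have key: "integrable D (\<lambda>z. eta D z * l (f (fst z)) + (1 - eta D z) * l (- f (fst z)))"
    "(\<integral>z. l (snd z * f (fst z)) \<partial>D) = (\<integral>z. eta D z * l (f (fst z)) + (1 - eta D z) * l (- f (fst z)) \<partial>D)"
    if l: "l \<in> borel_measurable borel" "\<And>t. \<bar>l t\<bar> \<le> B" for l :: "real \<Rightarrow> real" and B
  proof -
    have mF: "(\<lambda>z. l (f (fst z)) - l (- f (fst z))) \<in> borel_measurable F"
      using l(1) fF by measurable
    have mD: "(\<lambda>z. l (f (fst z)) - l (- f (fst z))) \<in> borel_measurable D" "(\<lambda>z. l (- f (fst z))) \<in> borel_measurable D"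
      using l(1) measurable_from_subalg[OF sub fF] by measurable
    have i1: "integrable D (\<lambda>z. (l (f (fst z)) - l (- f (fst z))) * u z)"
    proof (rule integrable_bounded_prob[OF D(1), where B = "2 * B"])
      show "\<bar>(l (f (fst z)) - l (- f (fst z))) * u z\<bar> \<le> 2 * B" for z
        using l(2)[of "f (fst z)"] l(2)[of "- f (fst z)"] by (auto simp: u_def indicator_def)
    qed (use mD in measurable)
    have i2: "integrable D (\<lambda>z. l (- f (fst z)))"
      by (rule integrable_bounded_prob[OF D(1) mD(2) l(2)])
    note c = real_cond_exp_intg[OF i1 mF um, folded eta]
    have e: "eta D z * l (f (fst z)) + (1 - eta D z) * l (- f (fst z))
        = (l (f (fst z)) - l (- f (fst z))) * eta D z + l (- f (fst z))" for z
      by (simp add: algebra_simps)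
    show "integrable D (\<lambda>z. eta D z * l (f (fst z)) + (1 - eta D z) * l (- f (fst z)))"
      unfolding e using c(1) i2 by simp
    have "l (snd z * f (fst z)) = (l (f (fst z)) - l (- f (fst z))) * u z + l (- f (fst z))" if "z \<in> space D" for z
      using that unfolding D(2) by (auto simp: u_def)
    then have "(\<integral>z. l (snd z * f (fst z)) \<partial>D) = (\<integral>z. (l (f (fst z)) - l (- f (fst z))) * u z + l (- f (fst z)) \<partial>D)"
      by (intro Bochner_Integration.integral_cong) auto
    also have "\<dots> = (\<integral>z. (l (f (fst z)) - l (- f (fst z))) * eta D z + l (- f (fst z)) \<partial>D)"
      using i1 i2 c by simp
    finally show "(\<integral>z. l (snd z * f (fst z)) \<partial>D) = (\<integral>z. eta D z * l (f (fst z)) + (1 - eta D z) * l (- f (fst z)) \<partial>D)"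
      unfolding e .
  qed
  have ld: "(\<lambda>t. loss_d d t \<rho>) \<in> borel_measurable borel"
    unfolding loss_d_indicator by measurable
  have ldr: "(\<lambda>t. loss_dr d t \<rho>) \<in> borel_measurable borel" "\<bar>loss_dr d t \<rho>\<bar> \<le> 2" for t
    using loss_dr_bounds[of d t \<rho>] d unfolding loss_dr_ramp by (measurable, auto)
  define m where "m e = min e (min d (1 - e))" for e
  have "integrable D u" by (intro integrable_bounded_prob[OF D(1) um, of 1]) (auto simp: u_def indicator_def)
  then have "integrable D (eta D)" unfolding eta by (rule real_cond_exp_int(1))
  then have im: "integrable D (\<lambda>z. m (eta D z))"
    unfolding m_def by (intro Bochner_Integration.integrable_min) auto
  have "bayes_risk_d D d = (\<integral>z. m (eta D z) \<partial>D)"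
    unfolding bayes_risk_d_def m_def using d by (simp add: xi_eq_min)
  moreover have "bayes_risk_dr D d = 2 * (\<integral>z. m (eta D z) \<partial>D)"
    unfolding bayes_risk_dr_def m_def using d by (simp add: cond_opt_dr_eq)
  moreover have "risk_d D d f \<rho> + (\<integral>z. m (eta D z) \<partial>D) \<le> risk_dr D d f \<rho>"
    unfolding risk_d_def risk_dr_def key(2)[OF ld abs_loss_d_le] key(2)[OF ldr]
      Bochner_Integration.integral_add[OF key(1)[OF ld abs_loss_d_le] im, symmetric]
    using d \<rho>
    by (intro integral_mono Bochner_Integration.integrable_add key(1)[OF ld abs_loss_d_le] im key(1)[OF ldr])
       (simp add: m_def cond_loss_dr_ge)
  ultimately show ?thesis by simp
qed

section \<open>The learning rate\<close>

text \<open>\<open>l2\<close> solves l1 / l2 = l2^beta, and \<open>l1\<close> is such that 1 / (l1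
  sqrt N) agrees with both. Terms in 1 / sqrt N alone are of no larger order because
  \<open>e\<close> is below 1/4.\<close>

lemma exponent_rates:
  fixes N :: nat and \<beta> :: real
  assumes N: "1 \<le> N" and \<beta>: "0 < \<beta>"
  defines "e \<equiv> \<beta> / (4 * \<beta> + 2)" and "l1 \<equiv> real N powr (- (\<beta> + 1) / (4 * \<beta> + 2))"
    and "l2 \<equiv> real N powr (- 1 / (4 * \<beta> + 2))"
  shows "0 < l1" "0 < l2" "1 \<le> 1 / l1" "l1 / l2 = real N powr - e" "l2 powr \<beta> = real N powr - e"
    "1 / l1 / sqrt N = real N powr - e" "1 / sqrt N \<le> real N powr - e"
proof -
  have N0: "0 < real N" "1 \<le> real N" using N by auto
  have sqrtN: "1 / sqrt N = real N powr - (1 / 2)"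
    unfolding powr_minus using powr_half_sqrt[of "real N"] by (simp add: inverse_eq_divide)
  have a: "1 / l1 = real N powr ((\<beta> + 1) / (4 * \<beta> + 2))"
    unfolding l1_def minus_divide_left[symmetric] powr_minus by (simp only: inverse_eq_divide divide_divide_eq_right mult_1 div_by_1)
  show "0 < l1" "0 < l2" using N0 by (auto simp: l1_def l2_def)
  show "1 \<le> 1 / l1"
    unfolding a using N0 \<beta> by (intro ge_one_powr_ge_zero) auto
  have "- (\<beta> + 1) / (4 * \<beta> + 2) - - 1 / (4 * \<beta> + 2) = - e"
    using \<beta> by (simp add: e_def field_simps)
  then show "l1 / l2 = real N powr - e"
    unfolding l1_def l2_def powr_diff[symmetric] by (rule arg_cong)
  show "l2 powr \<beta> = real N powr - e"
    unfolding l2_def e_def powr_powr by simp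
  have "1 / l1 / sqrt N = real N powr ((\<beta> + 1) / (4 * \<beta> + 2) + - (1 / 2))"
    unfolding powr_add sqrtN[symmetric] a[symmetric] by simp
  also have "(\<beta> + 1) / (4 * \<beta> + 2) + - (1 / 2) = - e"
    using \<beta> by (simp add: e_def field_simps)
  finally show "1 / l1 / sqrt N = real N powr - e" .
  show "1 / sqrt N \<le> real N powr - e"
    unfolding sqrtN using N0 \<beta> by (intro powr_mono) (auto simp: e_def field_simps)
qed

theorem theorem6:
  fixes X :: "(real ^ 'n) set"
    and D :: "((real ^ 'n) \<times> real) measure"
    and K :: "real ^ 'n \<Rightarrow> real ^ 'n \<Rightarrow> real"
    and H :: "(real ^ 'n \<Rightarrow> real) set"
    and ip :: "(real ^ 'n \<Rightarrow> real) \<Rightarrow> (real ^ 'n \<Rightarrow> real) \<Rightarrow> real"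
    and d \<beta> c\<^sub>\<beta> :: real
  assumes "0 < d" and "d < 1 / 2"
    and "labelled_distribution X D"
    and "mercer_kernel X K"
    and "bdd_above ((\<lambda>(x, y). sqrt \<bar>K x y\<bar>) ` (X \<times> X))"
    and "rkhs X K H ip"
    and "0 < \<beta>" and "\<beta> \<le> 1" and "0 < c\<^sub>\<beta>"
    and "\<And>lam2. 0 < lam2 \<Longrightarrow> approx_error D d H ip lam2 \<le> c\<^sub>\<beta> * lam2 powr \<beta>"
  shows "\<exists>c::real. \<forall>N\<ge>1. \<forall>\<delta>. 0 < \<delta> \<and> \<delta> \<le> 1 \<longrightarrow>
    iid_with_prob_ge D N (1 - \<delta>) (\<lambda>S. \<forall>h b \<rho>.
      sdr_svm_solution X K d N S (real N powr (- (\<beta> + 1) / (4 * \<beta> + 2))) h b \<rho> \<longrightarrow>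
      risk_d D d (\<lambda>x. h x + b) \<rho> - bayes_risk_d D d
        \<le> c * sqrt (ln (4 / \<delta>)) * real N powr (- \<beta> / (4 * \<beta> + 2)))"
proof -
  note dist = assms(3) and mercer = assms(4) and rk = assms(6)
  have d01: "0 \<le> d" "d \<le> 1" "d \<le> 1 / 2" using assms(1,2) by auto
  obtain M where M: "\<And>x y. x \<in> X \<Longrightarrow> y \<in> X \<Longrightarrow> sqrt \<bar>K x y\<bar> \<le> M"
    using assms(5) by (auto simp: bdd_above_def)
  define \<tau> where "\<tau> = max 0 M"
  have \<tau>: "0 \<le> \<tau>" by (simp add: \<tau>_def)
  have \<tau>K: "K x x \<le> \<tau>\<^sup>2" if "x \<in> X" for x
  proof -
    have "sqrt \<bar>K x x\<bar> \<le> \<tau>" using M[OF that that] by (simp add: \<tau>_def)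
    then have "\<bar>K x x\<bar> \<le> \<tau>\<^sup>2" by (rule sqrt_le_D)
    then show ?thesis by simp
  qed
  interpret rkhs X K H ip by (rule rk)
  interpret bounded_kernel_sample X K H ip D \<tau>
    by unfold_locales (use dist mercer \<tau> \<tau>K in auto)
  \<comment> \<open>\<open>C1\<close> is the factor of 1 / (l1 sqrt N) in the expected deviation for
    r = 2 / l1. In \<open>c\<close>, the 2 collects l1 / l2 and the slack in the choice of
    \<open>h0\<close>, and \<open>sqrt 8\<close> comes from McDiarmid's inequality.\<close>
  define C1 where "C1 = 2 * (2 * \<tau> + 4 * \<tau>\<^sup>2 + 2) * sqrt (\<tau>\<^sup>2 + 1)"
  define c where "c = C1 + c\<^sub>\<beta> + 2 + sqrt 8"
  have C1: "0 \<le> C1" using \<tau> by (simp add: C1_def)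
  show ?thesis
  proof (intro exI[of _ c] allI impI)
    fix N :: nat and \<delta> :: real
    assume N: "1 \<le> N" and "0 < \<delta> \<and> \<delta> \<le> 1"
    then have \<delta>: "0 < \<delta>" "\<delta> \<le> 1" and N0: "0 < N" by auto
    define l1 where "l1 = real N powr (- (\<beta> + 1) / (4 * \<beta> + 2))"
    define l2 where "l2 = real N powr (- 1 / (4 * \<beta> + 2))"
    define e where "e = real N powr - (\<beta> / (4 * \<beta> + 2))"
    note rates = exponent_rates[OF N assms(7), folded l1_def l2_def e_def]
    have e: "0 < e" using N0 by (simp add: e_def)
    define q where "q = sqrt (ln (4 / \<delta>))"
    \<comment> \<open>As 4 / \<delta> >= 4 > exp 1, the logarithmic factor is at least 1 and absorbs
      the terms free of \<delta>.\<close>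
    have q: "1 \<le> q"
    proof -
      have "exp 1 \<le> 4 / \<delta>" using mult_mono[OF \<delta>(2) exp_le] \<delta> by (simp add: field_simps)
      then have "1 \<le> ln (4 / \<delta>)" using \<delta> by (simp add: ln_ge_iff)
      then show ?thesis by (simp add: q_def)
    qed
    \<comment> \<open>The infimum in the approximation error need not be attained; an extra
      \<open>e\<close> gives a strict inequality and hence an actual triple \<open>h0\<close>,
      \<open>b0\<close>, \<open>\<rho>0\<close>, chosen before the sample.\<close>
    have "c\<^sub>\<beta> * l2 powr \<beta> < (c\<^sub>\<beta> + 1) * e"
      using rates(5) e by (simp add: algebra_simps)
    with assms(10)[OF rates(2)] have "approx_error D d H ip l2 < (c\<^sub>\<beta> + 1) * e" by simp
    moreover have "H \<times> (UNIV :: real set) \<times> {1 :: real..} \<noteq> {}" using zero_mem by auto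
    ultimately obtain h0 b0 \<rho>0 where h0: "h0 \<in> H" "1 \<le> \<rho>0"
      and approx: "l2 / 2 * (ip_norm ip h0)\<^sup>2 + risk_dr D d (\<lambda>x. h0 x + b0) \<rho>0 - bayes_risk_dr D d < (c\<^sub>\<beta> + 1) * e"
      unfolding approx_error_def by (auto dest!: cInf_lessD[rotated])
    have r: "0 \<le> 2 / l1" using rates(1) by simp
    let ?P = "Pi\<^sub>M {..<N} (\<lambda>_. D)"
    let ?R = "(2 * (\<tau> * (2 / l1) + 2 * (\<tau>\<^sup>2 * (2 / l1) + 1)) * sqrt (\<tau>\<^sup>2 + 1) + sqrt (8 * ln (4 / \<delta>))) / sqrt N"
    have R: "?R \<le> C1 * e + sqrt 8 * q * e"
    proof -
      \<comment> \<open>\<open>1 \<le> 1 / l1\<close> absorbs the additive constant that comes from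
        clipping.\<close>
      have "\<tau> * (2 / l1) + 2 * (\<tau>\<^sup>2 * (2 / l1) + 1) \<le> (2 * \<tau> + 4 * \<tau>\<^sup>2 + 2) * (1 / l1)"
        using rates(3) by (simp add: algebra_simps add_divide_distrib)
      then have "2 * (\<tau> * (2 / l1) + 2 * (\<tau>\<^sup>2 * (2 / l1) + 1)) * sqrt (\<tau>\<^sup>2 + 1)
          \<le> 2 * ((2 * \<tau> + 4 * \<tau>\<^sup>2 + 2) * (1 / l1)) * sqrt (\<tau>\<^sup>2 + 1)"
        by (intro mult_right_mono mult_left_mono) auto
      then have "2 * (\<tau> * (2 / l1) + 2 * (\<tau>\<^sup>2 * (2 / l1) + 1)) * sqrt (\<tau>\<^sup>2 + 1) \<le> C1 * (1 / l1)"
        by (simp add: C1_def)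
      then have "2 * (\<tau> * (2 / l1) + 2 * (\<tau>\<^sup>2 * (2 / l1) + 1)) * sqrt (\<tau>\<^sup>2 + 1) / sqrt N \<le> C1 * (1 / l1) / sqrt N"
        by (rule divide_right_mono) simp
      also have "\<dots> = C1 * e" unfolding rates(6)[symmetric] by simp
      finally have 1: "2 * (\<tau> * (2 / l1) + 2 * (\<tau>\<^sup>2 * (2 / l1) + 1)) * sqrt (\<tau>\<^sup>2 + 1) / sqrt N \<le> C1 * e" .
      have "sqrt (8 * ln (4 / \<delta>)) / sqrt N = sqrt 8 * q * (1 / sqrt N)"
        by (simp add: q_def real_sqrt_mult)
      also have "\<dots> \<le> sqrt 8 * q * e"
        using q rates(7) by (intro mult_left_mono) auto
      finally show ?thesis using 1 by (simp only: add_divide_distrib)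
    qed
    obtain E where E: "E \<in> sets ?P" "1 - \<delta> \<le> measure ?P E"
      and dev: "\<And>S c x b \<rho>. S \<in> E \<Longrightarrow> (\<forall>i. x i \<in> X) \<Longrightarrow> (\<Sum>i<N. \<bar>c i\<bar>) \<le> 2 / l1 \<Longrightarrow>
        (risk_dr D d (\<lambda>t. (\<Sum>i<N. c i * kernel_section X K (x i) t) + b) \<rho>
          - emp_risk_dr N S d (\<lambda>t. (\<Sum>i<N. c i * kernel_section X K (x i) t) + b) \<rho>)
        + (emp_risk_dr N S d (\<lambda>t. h0 t + b0) \<rho>0 - risk_dr D d (\<lambda>t. h0 t + b0) \<rho>0) \<le> ?R"
      using risk_dr_deviation[OF d01(1,2) N0 r \<delta> h0(1), of b0 \<rho>0] unfolding Let_def by blast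
    have "risk_d D d (\<lambda>x. h x + b) \<rho> - bayes_risk_d D d \<le> c * q * e"
      if S: "S \<in> E" and sol: "sdr_svm_solution X K d N S l1 h b \<rho>" for S h b \<rho>
    proof -
      have "S i \<in> space D" if "i < N" for i
        using sets.sets_into_space[OF E(1)] S that by (auto simp: space_PiM)
      then have SX: "fst (S i) \<in> X" "snd (S i) = 1 \<or> snd (S i) = - 1" if "i < N" for i
        using that unfolding space_D by fastforce+
      obtain \<alpha> where \<alpha>: "\<And>i. i < N \<Longrightarrow> 0 \<le> \<alpha> i" "h = kernel_expansion X K N S \<alpha>" "(\<Sum>i<N. \<alpha> i) \<le> 2 / l1"
        using sdr_svm_solution_expansion[OF sol rates(1) d01(1,3)] by metis
      \<comment> \<open>Indices from \<open>N\<close> on get the point of the first example, which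
        exists as \<open>1 \<le> N\<close>: the class requires every centre to lie in
        \<open>X\<close>.\<close>
      define x where "x i = fst (S (if i < N then i else 0))" for i
      define a where "a i = snd (S i) * \<alpha> i" for i
      have x: "\<forall>i. x i \<in> X" using SX(1) N0 by (simp add: x_def)
      have "(\<Sum>i<N. \<bar>a i\<bar>) = (\<Sum>i<N. \<alpha> i)"
      proof (intro sum.cong refl)
        fix i assume "i \<in> {..<N}"
        then show "\<bar>a i\<bar> = \<alpha> i" using SX(2)[of i] \<alpha>(1)[of i] by (auto simp: a_def)
      qed
      with \<alpha>(3) have a: "(\<Sum>i<N. \<bar>a i\<bar>) \<le> 2 / l1" by simp
      have h: "h = (\<lambda>t. \<Sum>i<N. a i * kernel_section X K (x i) t)"
        unfolding \<alpha>(2) kernel_expansion_def by (auto simp: a_def x_def)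
      have hb: "(\<lambda>x. h x + b) = (\<lambda>t. (\<Sum>i<N. a i * kernel_section X K (x i) t) + b)"
        by (simp add: h)
      have "h \<in> H" unfolding h using x by (intro expansion_mem) auto
      then have "continuous_on X (\<lambda>x. h x + b)"
        by (intro continuous_intros continuous_on_rkhs_mem[OF rk mercer])
      then have meas: "(\<lambda>x. h x + b) \<in> borel_measurable (restrict_space borel X)"
        by (rule borel_measurable_continuous_on_restrict)
      have "1 \<le> \<rho>" using sol by (simp add: sdr_svm_solution_def)
      from excess_risk_d_le_excess_risk_dr[OF dist assms(1,2) meas this]
      have "risk_d D d (\<lambda>x. h x + b) \<rho> - bayes_risk_d D d
        \<le> (risk_dr D d (\<lambda>x. h x + b) \<rho> - emp_risk_dr N S d (\<lambda>x. h x + b) \<rho>)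
          + emp_risk_dr N S d (\<lambda>x. h x + b) \<rho> - bayes_risk_dr D d"
        by simp
      also have "\<dots> \<le> (risk_dr D d (\<lambda>x. h x + b) \<rho> - emp_risk_dr N S d (\<lambda>x. h x + b) \<rho>)
          + (l1 / l2 + l2 / 2 * (ip_norm ip h0)\<^sup>2 + emp_risk_dr N S d (\<lambda>x. h0 x + b0) \<rho>0) - bayes_risk_dr D d"
        using sdr_svm_solution_emp_risk_le[OF rk sol N0 rates(1,2) d01(1,2) SX h0, of b0] by simp
      also have "\<dots> \<le> ?R + e + (c\<^sub>\<beta> + 1) * e"
        using dev[OF S x a, of b \<rho>, folded hb] approx rates(4) by linarith
      also have "\<dots> \<le> C1 * e + sqrt 8 * q * e + e + (c\<^sub>\<beta> + 1) * e" using R by simp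
      also have "\<dots> = (C1 + c\<^sub>\<beta> + 2) * e + sqrt 8 * q * e" by (simp add: algebra_simps)
      also have "(C1 + c\<^sub>\<beta> + 2) * e \<le> (C1 + c\<^sub>\<beta> + 2) * (q * e)"
        using q e C1 assms(9) by (intro mult_left_mono) auto
      finally show ?thesis by (simp add: c_def algebra_simps)
    qed
    then show "iid_with_prob_ge D N (1 - \<delta>) (\<lambda>S. \<forall>h b \<rho>.
        sdr_svm_solution X K d N S (real N powr (- (\<beta> + 1) / (4 * \<beta> + 2))) h b \<rho> \<longrightarrow>
        risk_d D d (\<lambda>x. h x + b) \<rho> - bayes_risk_d D d
          \<le> c * sqrt (ln (4 / \<delta>)) * real N powr (- \<beta> / (4 * \<beta> + 2)))"
      unfolding iid_with_prob_ge_def l1_def[symmetric] q_def[symmetric]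
        minus_divide_left[symmetric, of \<beta>] e_def[symmetric]
      using E by blast
  qed
qed

end
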